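(* Let $d\ge2$, let $V,\alpha,\omega,B,\Omega,L$ be as fixed in the context, put $\beta=B\alpha$ and $W(B\theta)=\partial_\alpha V(\theta)$ with $\partial_\alpha=\alpha\cdot\nabla$, and assume that $W$ is analytic. Assume that $$\lim_{N\to\infty}\frac1N\ \sup_{k\in\mathbb{Z}^{d-1},\,0<|k|\le N}\big|\ln \mathrm{dist}(k\cdot\Omega,\mathbb{Z})\big|=0 .$$ Let $v(\psi,\eta)=\sum_{n\ge0}\epsilon^nv^n(\psi,\eta)$ and $\lambda(\eta,\epsilon)=\sum_{n\ge0}\epsilon^n\lambda^n(\eta)$ be the normalized formal power series solution described in the context. Let $\eta^*\in\mathbb{T}^1$ be such that $$\int_{\mathbb{T}^{d-1}}W(\psi,\eta^* )\,d\psi=0\qquad\text{and}\qquad \int_{\mathbb{T}^{d-1}}\frac{\partial W}{\partial\eta}(\psi,\eta^* )\,d\psi\neq0 .$$ Then there is a formal power series $\eta_\epsilon=\eta^*+\sum_{n\ge1}\epsilon^n\eta_n$ in $\epsilon$ such that $\lambda(\eta_\epsilon,\epsilon)=0$ as a formal power series in $\epsilon$. Consequently $v(\psi,\eta_\epsilon)$ solves, in the sense of formal power series in $\epsilon$, $$v(\psi+\Omega,\eta_\epsilon)+v(\psi-\Omega,\eta_\epsilon)-2v(\psi,\eta_\epsilon)+\epsilon\,W\big((\psi,\eta_\epsilon)+\beta v(\psi,\eta_\epsilon)\big)=0 .$$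
   Context: Notation: $\mathbb{T}^j=\mathbb{R}^j/\mathbb{Z}^j$. Points of $\mathbb{T}^d$ are written $(\psi,\eta)$ with $\psi\in\mathbb{T}^{d-1}$, $\eta\in\mathbb{T}^1$. $\mathrm{dist}(x,\mathbb{Z})$ is the distance from $x\in\mathbb{R}$ to the nearest integer, $|\ln 0|=+\infty$, and $|k|=\sum_i|k_i|$. Setting: $V:\mathbb{T}^d\to\mathbb{R}$ is analytic, and $\alpha\in\mathbb{R}^d$ satisfies $k\cdot\alpha\ne0$ for all $k\in\mathbb{Z}^d\setminus\{0\}$. The number $\omega\in\mathbb{R}$ is resonant, i.e. there are $k\in\mathbb{Z}^d\setminus\{0\}$ and $m\in\mathbb{Z}$ with $k\cdot\omega\alpha=m$. The matrix $B\in SL(d,\mathbb{Z})$, the vector $\Omega\in\mathbb{R}^{d-1}$ and $L\in\mathbb{Z}^d$ are such that $B\omega\alpha=(\Omega,0)+L$ and $\Omega\cdot k\notin\mathbb{Z}$ for all $k\in\mathbb{Z}^{d-1}\setminus\{0\}$. Normalized formal solution: $(v,\lambda)$ is the formal power series in $\epsilon$ (superscripts are indices, not powers), with coefficients $v^n$ real analytic on $\mathbb{T}^d$ and $\lambda^n$ real analytic on $\mathbb{T}^1$, uniquely determined by $$v(\psi+\Omega,\eta)+v(\psi-\Omega,\eta)-2v(\psi,\eta)+\epsilon\, W\big((\psi,\eta)+\beta v(\psi,\eta)\big)+\lambda(\eta,\epsilon)=0$$ (to all orders in $\epsilon$, with $W(\cdot)$ expanded by Taylor's formula) together with the normalization $\int_{\mathbb{T}^{d-1}}v(\psi,\eta)\,d\psi=0$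 for all $\eta$ (to all orders in $\epsilon$). In particular $v^0=0$, $\lambda^0=0$ and $\lambda^1(\eta)=-\int_{\mathbb{T}^{d-1}}W(\psi,\eta)\,d\psi$. Substituting the formal power series $\eta_\epsilon$ for $\eta$ means Taylor expanding the coefficients in $\eta$ around $\eta^*$ and collecting powers of $\epsilon$. *)

theory Defs
  imports "HOL-Analysis.Analysis"
begin

section \<open>Functions on the torus\<close>

text \<open>
  A function on the torus \<open>\<real>\<^sup>j/\<int>\<^sup>j\<close> is represented by its lift to \<open>\<real>\<^sup>j\<close>, which is periodic with
  period 1 in each coordinate direction. Multi-indices are the extensional functions from
  \<^term>\<open>Basis\<close> to the natural numbers; convergence in the sense of \<open>has_sum\<close> over the set of all of them is
  unconditional, hence absolute, convergence of the multivariate power series.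
\<close>

definition torus_fun :: "('a::euclidean_space \<Rightarrow> real) \<Rightarrow> bool" where
  "torus_fun f \<longleftrightarrow> (\<forall>x. \<forall>b\<in>Basis. f (x + b) = f x)"

definition real_analytic :: "('a::euclidean_space \<Rightarrow> real) \<Rightarrow> bool" where
  "real_analytic f \<longleftrightarrow>
     (\<forall>x. \<exists>c :: ('a \<Rightarrow> nat) \<Rightarrow> real. \<exists>r>0. \<forall>y\<in>ball x r.
        ((\<lambda>\<mu>. c \<mu> * (\<Prod>b\<in>Basis. ((y - x) \<bullet> b) ^ \<mu> b)) has_sum f y) (Basis \<rightarrow>\<^sub>E UNIV))"

definition torus_analytic :: "('a::euclidean_space \<Rightarrow> real) \<Rightarrow> bool" where
  "torus_analytic f \<longleftrightarrow> torus_fun f \<and> real_analytic f"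

text \<open>\<open>a \<cdot> \<nabla>f\<close>; meaningful for differentiable \<open>f\<close>.\<close>

definition dir_deriv :: "'a::euclidean_space \<Rightarrow> ('a \<Rightarrow> real) \<Rightarrow> 'a \<Rightarrow> real" where
  "dir_deriv a f x = frechet_derivative f (at x) a"

definition partials :: "'a::euclidean_space list \<Rightarrow> ('a \<Rightarrow> real) \<Rightarrow> 'a \<Rightarrow> real" where
  "partials w f = foldr dir_deriv w f"

section \<open>Coordinates, integer vectors\<close>

text \<open>
  With \<open>CARD('m) = d - 1\<close>, points of \<open>\<real>\<^sup>d\<close> are vectors indexed by \<^typ>\<open>'m option\<close>, the index
  \<^term>\<open>None\<close> being the last coordinate. As \<^typ>\<open>'m\<close> is nonempty, \<open>d \<ge> 2\<close> is automatic.
\<close>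

definition point :: "real ^ 'm \<Rightarrow> real \<Rightarrow> real ^ ('m::finite option)" where
  "point \<psi> \<eta> = (\<chi> i. case i of None \<Rightarrow> \<eta> | Some j \<Rightarrow> vec_nth \<psi> j)"

definition real_vec :: "int ^ 'n \<Rightarrow> real ^ ('n::finite)" where
  "real_vec k = (\<chi> i. real_of_int (vec_nth k i))"

definition norm1 :: "int ^ ('n::finite) \<Rightarrow> int" where
  "norm1 k = (\<Sum>i\<in>UNIV. \<bar>vec_nth k i\<bar>)"

definition torus_integral :: "(real ^ ('m::finite) \<Rightarrow> real) \<Rightarrow> real" where
  "torus_integral f = integral (cbox 0 1) f"

text \<open>The convention \<open>|ln 0| = \<infinity>\<close>; the library has \<^term>\<open>ln 0 = (0::real)\<close>.\<close>

definition abs_ln :: "real \<Rightarrow> ereal" where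
  "abs_ln x = (if x = 0 then \<infinity> else ereal \<bar>ln x\<bar>)"

definition small_divisor_condition :: "real ^ ('m::finite) \<Rightarrow> bool" where
  "small_divisor_condition \<Omega> \<longleftrightarrow>
     (\<lambda>N::nat. ereal (1 / real N) *
        (SUP k\<in>{k :: int ^ 'm. 0 < norm1 k \<and> norm1 k \<le> int N}.
            abs_ln (infdist (real_vec k \<bullet> \<Omega>) \<int>))) \<longlonglongrightarrow> 0"

section \<open>Substitution of formal power series\<close>

text \<open>
  The formal power series \<open>f(X)\<close> for a smooth \<open>f\<close> and a vector-valued formal power series
  \<open>X = x\<^sub>0 + h\<close>, by Taylor's formula
  \<open>f(x\<^sub>0 + h) = \<Sum>\<^sub>j (1/j!) \<Sum> \<partial>\<^sub>b\<^sub>1 \<dots> \<partial>\<^sub>b\<^sub>j f(x\<^sub>0) h\<^sub>b\<^sub>1 \<dots> h\<^sub>b\<^sub>j\<close>,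
  where the inner sum is over all words in the coordinate directions of length \<open>j\<close>. As \<open>h\<close> has
  no constant term, only \<open>j \<le> n\<close> contributes to the coefficient of order \<open>n\<close>.
\<close>

definition taylor_subst :: "('a::euclidean_space \<Rightarrow> real) \<Rightarrow> 'a fps \<Rightarrow> real fps" where
  "taylor_subst f X =
     (let x0 = fps_nth X 0; h = (\<lambda>b. Abs_fps (\<lambda>m. fps_nth (X - fps_const x0) m \<bullet> b))
      in Abs_fps (\<lambda>n. \<Sum>j\<le>n. \<Sum>w | set w \<subseteq> Basis \<and> length w = j.
           partials w f x0 / fact j * fps_nth (prod_list (map h w)) n))"

text \<open>
  The series \<open>\<Sum>\<^sub>n \<epsilon>\<^sup>n F\<^sup>n(X)\<close>: each coefficient function \<open>F\<^sup>n\<close> is expanded at the formal power series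
  \<open>X\<close> and powers of \<open>\<epsilon>\<close> are collected.
\<close>

definition series_subst :: "(nat \<Rightarrow> 'a::euclidean_space \<Rightarrow> real) \<Rightarrow> 'a fps \<Rightarrow> real fps" where
  "series_subst F X = Abs_fps (\<lambda>n. \<Sum>i\<le>n. fps_nth (taylor_subst (F i) X) (n - i))"

section \<open>The normalized formal solution\<close>

definition normalized_formal_solution ::
  "(real ^ ('m::finite option) \<Rightarrow> real) \<Rightarrow> real ^ ('m option) \<Rightarrow> real ^ 'm \<Rightarrow>
   (nat \<Rightarrow> real ^ ('m option) \<Rightarrow> real) \<Rightarrow> (nat \<Rightarrow> real \<Rightarrow> real) \<Rightarrow> bool" where
  "normalized_formal_solution W \<beta> \<Omega> v lam \<longleftrightarrow>
     (\<forall>n. torus_analytic (v n)) \<and> (\<forall>n. torus_analytic (lam n)) \<and>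
     (\<forall>\<psi> \<eta>.
        Abs_fps (\<lambda>n. v n (point (\<psi> + \<Omega>) \<eta>)) + Abs_fps (\<lambda>n. v n (point (\<psi> - \<Omega>) \<eta>))
        - 2 * Abs_fps (\<lambda>n. v n (point \<psi> \<eta>))
        + fps_X * taylor_subst W
            (fps_const (point \<psi> \<eta>) + Abs_fps (\<lambda>n. v n (point \<psi> \<eta>) *\<^sub>R \<beta>))
        + Abs_fps (\<lambda>n. lam n \<eta>) = 0) \<and>
     (\<forall>n \<eta>. torus_integral (\<lambda>\<psi>. v n (point \<psi> \<eta>)) = 0)"

text \<open>\<open>v(\<psi>,\<eta>\<^sub>\<epsilon>)\<close> for a formal power series \<open>\<eta>\<^sub>\<epsilon>\<close>.\<close>

definition subst_eta ::
  "(nat \<Rightarrow> real ^ ('m::finite option) \<Rightarrow> real) \<Rightarrow> real fps \<Rightarrow> real ^ 'm \<Rightarrow> real fps" where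
  "subst_eta v H \<psi> = series_subst (\<lambda>n \<eta>. v n (point \<psi> \<eta>)) H"

end

theory Submission
  imports Defs
begin

text \<open>
  A formal substitution \<open>f(X)\<close> is characterised by \<open>f(X\<^sub>N(t)) = \<Sum>\<^sub>n\<^sub>\<le>\<^sub>N [f(X)]\<^sub>n t\<^sup>n + O(t\<^sup>N\<^sup>+\<^sup>1)\<close>,
  where \<open>X\<^sub>N\<close> is the truncation of \<open>X\<close>, with a constant that is uniform for bounded \<open>X\<close>. Hence the
  formal equation, which holds at every fixed \<open>\<eta>\<close>, may be evaluated at \<open>\<eta> = H\<^sub>N(t)\<close>; comparing
  coefficients gives the equation with \<open>\<eta>\<^sub>\<epsilon> = H\<close> substituted, and no chain rule for
  formal series is needed. For the existence of \<open>H\<close>: by translation invariance of the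
  integral and density of the orbits of \<open>\<Omega>\<close> (Kronecker), \<open>v\<^sup>0 = 0\<close>, \<open>\<lambda>\<^sup>0 = 0\<close> and
  \<open>\<lambda>\<^sup>1(\<eta>) = - \<integral> W(\<psi>, \<eta>) d\<psi>\<close>. So \<open>\<lambda>\<^sup>1\<close> has a simple zero at \<open>\<eta>\<^sup>*\<close>, and the coefficient of \<open>\<epsilon>\<^sup>m\<^sup>+\<^sup>1\<close> in
  \<open>\<lambda>(H, \<epsilon>)\<close> determines the \<open>m\<close>-th coefficient of \<open>H\<close> from the lower ones.
\<close>

section \<open>Power series and real analytic functions\<close>

text \<open>The series H enters the second argument of v, which itself sits inside W. Truncation
  turns this nesting into ordinary composition of real functions, at the price of uniformity: when
  \<eta> = H_N(t), the inner series (\<psi>,\<eta>) + \<beta> v(\<psi>,\<eta>) changes with t, so an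
  error constant belonging to one fixed series says nothing. Every Taylor estimate below therefore
  fixes its constant before the point, the increment or the series.

  Multiplication by \<epsilon> creates one term of degree N+1 whose coefficient is a function of
  \<eta> given only as a Taylor coefficient of W. Its continuity is read off from the formal
  equation itself.

  Analyticity is used through the existence and continuity of all iterated partial derivatives.
  \<open>real_analytic\<close> supplies only local convergent series, so these must first be
  differentiated term by term.

  The implicit function step is degenerate, since \<lambda> starts at order one; in effect
  \<lambda>/\<epsilon> = 0 is solved.\<close>

lemma has_derivative_infsum:
  fixes f :: "'i \<Rightarrow> 'a::real_normed_vector \<Rightarrow> real"
  assumes I: "countable I" "infinite I" and S: "convex S" "x \<in> S"
    and der: "\<And>i y. i \<in> I \<Longrightarrow> y \<in> S \<Longrightarrow> (f i has_derivative f' i y) (at y within S)"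
    and bound: "\<And>i y h. i \<in> I \<Longrightarrow> y \<in> S \<Longrightarrow> \<bar>f' i y h\<bar> \<le> M i * norm h"
    and M: "M summable_on I"
    and F: "\<And>y. y \<in> S \<Longrightarrow> ((\<lambda>i. f i y) has_sum F y) I"
  shows "(F has_derivative (\<lambda>h. \<Sum>\<^sub>\<infinity>i\<in>I. f' i x h)) (at x within S)"
proof -
  \<comment> \<open>An enumeration turns the unordered sums into series, the setting of
    \<open>has_derivative_series\<close>.\<close>
  define e where "e = from_nat_into I"
  have e: "bij_betw e UNIV I"
    using I unfolding e_def by (intro bij_betw_from_nat_into) auto
  have eI: "e n \<in> I" for n
    using e by (auto simp: bij_betw_def)
  define g' where "g' y h = (\<Sum>\<^sub>\<infinity>i\<in>I. f' i y h)" for y h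
  have Me: "summable (\<lambda>n. M (e n))"
    using M summable_on_reindex_bij_betw[OF e, of M] summable_on_imp_summable by blast
  have sums': "(\<lambda>n. f' (e n) y h) sums g' y h" if "y \<in> S" for y h
  proof -
    have "(\<lambda>i. norm (f' i y h)) summable_on I"
      by (rule Infinite_Sum.abs_summable_on_comparison_test'[OF summable_on_cmult_left[OF M, of "norm h"]])
        (use bound[OF _ that] in simp)
    then have "((\<lambda>i. f' i y h) has_sum g' y h) I"
      unfolding g'_def by (rule has_sum_infsum[OF abs_summable_summable])
    then show ?thesis
      using has_sum_reindex_bij_betw[OF e, of "\<lambda>i. f' i y h"] has_sum_imp_sums by blast
  qed
  \<comment> \<open>Weierstrass test: the majorant M bounds the tails of the differentials uniformly
    in y, relative to \<open>norm h\<close>.\<close>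
  have tail: "\<bar>(\<Sum>i<n. f' (e i) y h) - g' y h\<bar> \<le> (\<Sum>k. M (e (k + n))) * norm h" if "y \<in> S" for y h n
  proof -
    have s: "(\<lambda>k. f' (e (k + n)) y h) sums (g' y h - (\<Sum>i<n. f' (e i) y h))"
      using sums_split_initial_segment[OF sums'[OF that]] .
    have M': "summable (\<lambda>k. M (e (k + n)) * norm h)"
      using Me summable_ignore_initial_segment summable_mult2 by blast
    have "norm (\<Sum>k. f' (e (k + n)) y h) \<le> (\<Sum>k. M (e (k + n)) * norm h)"
      by (rule norm_suminf_le[OF _ M']) (use bound eI that in auto)
    also have "\<dots> = (\<Sum>k. M (e (k + n))) * norm h"
      by (rule suminf_mult2[symmetric]) (use Me summable_ignore_initial_segment in blast)
    finally show ?thesis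
      using sums_unique[OF s] by (simp add: abs_minus_commute)
  qed
  have "\<exists>g. \<forall>y\<in>S. (\<lambda>n. f (e n) y) sums g y \<and> (g has_derivative g' y) (at y within S)"
  proof (rule has_derivative_series[OF S(1) _ _ S(2)])
    show "\<And>n y. y \<in> S \<Longrightarrow> (f (e n) has_derivative f' (e n) y) (at y within S)"
      using der eI by blast
    show "(\<lambda>n. f (e n) x) sums F x"
      using has_sum_reindex_bij_betw[OF e, of "\<lambda>i. f i x"] has_sum_imp_sums F S(2) by blast
    show "\<forall>\<^sub>F n in sequentially. \<forall>y\<in>S. \<forall>h. norm ((\<Sum>i<n. f' (e i) y h) - g' y h) \<le> \<epsilon> * norm h"
      if "\<epsilon> > 0" for \<epsilon> :: real
    proof -
      obtain N where N: "\<And>n. n \<ge> N \<Longrightarrow> norm (\<Sum>k. M (e (k + n))) < \<epsilon>"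
        using suminf_exist_split[OF \<open>\<epsilon> > 0\<close> Me] by blast
      show ?thesis
        unfolding eventually_sequentially
      proof (intro exI allI impI ballI)
        fix n y h assume n: "N \<le> n" and y: "y \<in> S"
        have "\<bar>(\<Sum>i<n. f' (e i) y h) - g' y h\<bar> \<le> (\<Sum>k. M (e (k + n))) * norm h"
          by (rule tail[OF y])
        also have "\<dots> \<le> \<epsilon> * norm h"
          using N[OF n] by (intro mult_right_mono) auto
        finally show "norm ((\<Sum>i<n. f' (e i) y h) - g' y h) \<le> \<epsilon> * norm h" by simp
      qed
    qed
  qed
  then obtain g where g: "\<And>y. y \<in> S \<Longrightarrow> (\<lambda>n. f (e n) y) sums g y"
    "\<And>y. y \<in> S \<Longrightarrow> (g has_derivative g' y) (at y within S)" by blast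
  have "g y = F y" if "y \<in> S" for y
    using g(1)[OF that] F[OF that] has_sum_reindex_bij_betw[OF e, of "\<lambda>i. f i y"]
      has_sum_imp_sums sums_unique2 by metis
  then have "(F has_derivative g' x) (at x within S)"
    using has_derivative_transform[OF S(2) _ g(2)[OF S(2)]] by metis
  then show ?thesis
    unfolding g'_def .
qed

section \<open>Monomials and their partial derivatives\<close>

definition monomial :: "('a::euclidean_space \<Rightarrow> nat) \<Rightarrow> 'a \<Rightarrow> real" where
  "monomial \<mu> z = (\<Prod>b\<in>Basis. (z \<bullet> b) ^ \<mu> b)"

definition total_degree :: "('a::euclidean_space \<Rightarrow> nat) \<Rightarrow> nat" where
  "total_degree \<mu> = (\<Sum>b\<in>Basis. \<mu> b)"

text \<open>For \<open>\<mu> b = 0\<close> the truncated subtraction leaves the exponent at 0, but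
  the factor \<open>real (\<mu> b)\<close> makes the whole expression vanish, as it should.\<close>

definition monomial_partial :: "'a \<Rightarrow> ('a::euclidean_space \<Rightarrow> nat) \<Rightarrow> 'a \<Rightarrow> real" where
  "monomial_partial b \<mu> z = real (\<mu> b) * monomial (\<mu>(b := \<mu> b - 1)) z"

lemma has_derivative_monomial:
  fixes z :: "'a::euclidean_space"
  shows "(monomial \<mu> has_derivative (\<lambda>h. \<Sum>b\<in>Basis. (h \<bullet> b) * monomial_partial b \<mu> z)) (at z within S)"
proof -
  have upd: "(\<Prod>j\<in>Basis. (z \<bullet> j) ^ ((\<mu>(b := k)) j)) = (z \<bullet> b) ^ k * (\<Prod>j\<in>Basis - {b}. (z \<bullet> j) ^ \<mu> j)"
    if "b \<in> Basis" for b k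
    by (subst prod.remove[OF _ that]) (auto intro!: prod.cong)
  have "((\<lambda>z. \<Prod>b\<in>Basis. (z \<bullet> b) ^ \<mu> b) has_derivative
      (\<lambda>h. \<Sum>b\<in>Basis. (real (\<mu> b) * (h \<bullet> b) * (z \<bullet> b) ^ (\<mu> b - 1)) * (\<Prod>j\<in>Basis - {b}. (z \<bullet> j) ^ \<mu> j)))
      (at z within S)"
    by (rule has_derivative_prod) (auto intro!: derivative_eq_intros simp: mult_ac)
  then show ?thesis
    unfolding monomial_def[abs_def] monomial_partial_def
    by (rule has_derivative_eq_rhs)
      (auto simp: upd[unfolded fun_upd_apply] monomial_def fun_eq_iff mult_ac intro!: sum.cong)
qed

lemma abs_monomial_le:
  fixes z :: "'a::euclidean_space"
  assumes "\<And>b. b \<in> Basis \<Longrightarrow> \<bar>z \<bullet> b\<bar> \<le> \<rho>"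
  shows "\<bar>monomial \<mu> z\<bar> \<le> \<rho> ^ total_degree \<mu>"
  unfolding monomial_def total_degree_def power_sum abs_prod
  by (intro prod_mono) (auto simp: power_abs intro!: power_mono assms)

text \<open>Differentiation costs a factor n, at most the degree d. As n is at most 2^d, halving the
  radius pays for it.\<close>

lemma mult_half_power_le:
  fixes s :: real
  assumes "s > 0" "0 < n" "n \<le> d"
  shows "real n * (s / 2) ^ (d - 1) \<le> 2 / s * s ^ d"
proof -
  obtain k where d: "d = Suc k" using assms by (cases d) auto
  have "n \<le> 2 ^ d"
    using assms(3) less_exp[of d] by linarith
  then have "real n \<le> 2 ^ d"
    by (metis of_nat_le_iff of_nat_numeral of_nat_power)
  then have "real n * (s / 2) ^ k \<le> 2 ^ d * (s / 2) ^ k"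
    using assms(1) by (intro mult_right_mono) auto
  also have "\<dots> = 2 / s * s ^ d"
    using assms(1) by (simp add: d power_divide)
  finally show ?thesis by (simp add: d)
qed

lemma abs_monomial_partial_le:
  fixes z :: "'a::euclidean_space"
  assumes "s > 0" "b \<in> Basis" "\<And>b. b \<in> Basis \<Longrightarrow> \<bar>z \<bullet> b\<bar> \<le> s / 2"
  shows "\<bar>monomial_partial b \<mu> z\<bar> \<le> 2 / s * s ^ total_degree \<mu>"
proof (cases "\<mu> b = 0")
  case True
  then show ?thesis using assms(1) by (simp add: monomial_partial_def)
next
  case False
  have deg: "total_degree \<mu> = \<mu> b + (\<Sum>j\<in>Basis - {b}. \<mu> j)"
    unfolding total_degree_def by (rule sum.remove) (use assms in auto)
  have deg': "total_degree (\<mu>(b := \<mu> b - 1)) = total_degree \<mu> - 1"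
  proof -
    have "total_degree (\<mu>(b := \<mu> b - 1)) = (\<mu> b - 1) + (\<Sum>j\<in>Basis - {b}. \<mu> j)"
      unfolding total_degree_def
      by (subst sum.remove[OF _ assms(2)]) (auto intro!: sum.cong)
    then show ?thesis using deg False by simp
  qed
  have "\<bar>monomial_partial b \<mu> z\<bar> \<le> real (\<mu> b) * (s / 2) ^ (total_degree \<mu> - 1)"
    unfolding monomial_partial_def abs_mult deg'[symmetric]
    by (intro mult_mono abs_monomial_le) (use assms in auto)
  also have "\<dots> \<le> 2 / s * s ^ total_degree \<mu>"
    by (rule mult_half_power_le) (use assms False deg in auto)
  finally show ?thesis .
qed

lemma countable_infinite_multi_indices:
  "countable (Basis \<rightarrow>\<^sub>E UNIV :: ('a::euclidean_space \<Rightarrow> nat) set)"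
  "infinite (Basis \<rightarrow>\<^sub>E UNIV :: ('a::euclidean_space \<Rightarrow> nat) set)"
proof -
  show "countable (Basis \<rightarrow>\<^sub>E UNIV :: ('a \<Rightarrow> nat) set)"
    by (intro countable_PiE) auto
  obtain b :: 'a where b: "b \<in> Basis" using nonempty_Basis by blast
  have "range (\<lambda>n::nat. restrict (\<lambda>_. n) (Basis::'a set)) \<subseteq> Basis \<rightarrow>\<^sub>E UNIV" by auto
  moreover have "inj (\<lambda>n::nat. restrict (\<lambda>_. n) (Basis::'a set))"
    by (rule injI) (use b in \<open>metis restrict_apply'\<close>)
  ultimately show "infinite (Basis \<rightarrow>\<^sub>E UNIV :: ('a \<Rightarrow> nat) set)"
    using finite_subset range_inj_infinite by blast
qed

text \<open>Convergence at a single point all of whose coordinates differ from those of x by the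
  same s > 0 gives absolute convergence on the polydisc of radius s. On the polydisc of radius s/2
  the differentiated series then has a summable majorant, and \<open>has_derivative_infsum\<close>
  applies.\<close>

lemma real_analytic_local_derivative:
  fixes f :: "'a::euclidean_space \<Rightarrow> real"
  assumes "real_analytic f"
  obtains c \<rho> where "\<rho> > 0"
    "\<And>y. y \<in> ball x \<rho> \<Longrightarrow> f differentiable (at y)"
    "\<And>y b. y \<in> ball x \<rho> \<Longrightarrow> b \<in> Basis \<Longrightarrow>
       ((\<lambda>\<mu>. c \<mu> * monomial_partial b \<mu> (y - x)) has_sum dir_deriv b f y) (Basis \<rightarrow>\<^sub>E UNIV)"
proof -
  let ?I = "Basis \<rightarrow>\<^sub>E UNIV :: ('a \<Rightarrow> nat) set"
  obtain c :: "('a \<Rightarrow> nat) \<Rightarrow> real" and r where r: "r > 0"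
    and c: "\<And>y. y \<in> ball x r \<Longrightarrow> ((\<lambda>\<mu>. c \<mu> * monomial \<mu> (y - x)) has_sum f y) ?I"
    using assms unfolding real_analytic_def monomial_def by blast
  \<comment> \<open>The test point \<open>y0\<close> below is x shifted by s in every coordinate;
    its distance from x is at most the l1 norm \<open>DIM('a) * s = r / 2\<close>, so it stays
    inside the ball of convergence.\<close>
  define s where "s = r / (2 * DIM('a))"
  have s: "s > 0" using r by (simp add: s_def)
  define y0 where "y0 = x + (\<Sum>b\<in>Basis. s *\<^sub>R b)"
  have y0b: "(y0 - x) \<bullet> b = s" if "b \<in> Basis" for b
    using that by (simp add: y0_def)
  have "norm (y0 - x) \<le> (\<Sum>b\<in>(Basis::'a set). \<bar>(y0 - x) \<bullet> b\<bar>)"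
    by (rule norm_le_l1)
  also have "\<dots> = r / 2" using r by (simp add: y0b s_def)
  finally have y0: "y0 \<in> ball x r" using r by (simp add: dist_norm norm_minus_commute)
  have mono0: "monomial \<mu> (y0 - x) = s ^ total_degree \<mu>" for \<mu>
    unfolding monomial_def total_degree_def power_sum by (intro prod.cong) (auto simp: y0b)
  have summ: "(\<lambda>\<mu>. \<bar>c \<mu>\<bar> * s ^ total_degree \<mu>) summable_on ?I"
  proof -
    have "(\<lambda>\<mu>. c \<mu> * s ^ total_degree \<mu>) summable_on ?I"
      using has_sum_imp_summable[OF c[OF y0]] unfolding mono0 .
    then have "(\<lambda>\<mu>. norm (c \<mu> * s ^ total_degree \<mu>)) summable_on ?I"
      by (rule iffD1[OF summable_on_iff_abs_summable_on_real])
    then show ?thesis using s by (simp add: abs_mult)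
  qed
  define K where "K \<mu> = \<bar>c \<mu>\<bar> * (2 / s * s ^ total_degree \<mu>)" for \<mu>
  have K: "K summable_on ?I"
    using summable_on_cmult_right[OF summ, of "2/s"] unfolding K_def by (simp add: mult_ac)
  \<comment> \<open>The bound s/2 is for the majorant K of the derivatives, the bound r for the
    given expansion of f.\<close>
  define \<rho> where "\<rho> = min (s / 2) r"
  have \<rho>: "\<rho> > 0" using s r by (simp add: \<rho>_def)
  have le: "\<bar>c \<mu> * monomial_partial b \<mu> (y - x)\<bar> \<le> K \<mu>" if "y \<in> ball x \<rho>" "b \<in> Basis" for y b \<mu>
  proof -
    have "\<bar>(y - x) \<bullet> b'\<bar> \<le> s / 2" if "b' \<in> Basis" for b'
      using Basis_le_norm[OF that, of "y - x"] \<open>y \<in> ball x \<rho>\<close>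
      by (simp add: \<rho>_def dist_norm norm_minus_commute)
    then show ?thesis
      unfolding K_def abs_mult by (intro mult_left_mono abs_monomial_partial_le s that) auto
  qed
  have summ': "(\<lambda>\<mu>. c \<mu> * monomial_partial b \<mu> (y - x)) summable_on ?I" if "y \<in> ball x \<rho>" "b \<in> Basis" for y b
  proof -
    have "(\<lambda>\<mu>. norm (c \<mu> * monomial_partial b \<mu> (y - x))) summable_on ?I"
      by (rule Infinite_Sum.abs_summable_on_comparison_test'[OF K]) (use le that in auto)
    then show ?thesis by (rule abs_summable_summable)
  qed
  define f' where "f' \<mu> y h = c \<mu> * (\<Sum>b\<in>Basis. (h \<bullet> b) * monomial_partial b \<mu> (y - x))" for \<mu> y h
  have der: "(f has_derivative (\<lambda>h. \<Sum>\<^sub>\<infinity>\<mu>\<in>?I. f' \<mu> y h)) (at y)" if y: "y \<in> ball x \<rho>" for y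
  proof -
    have "(f has_derivative (\<lambda>h. \<Sum>\<^sub>\<infinity>\<mu>\<in>?I. f' \<mu> y h)) (at y within ball x \<rho>)"
    proof (rule has_derivative_infsum[OF countable_infinite_multi_indices _ y, where M="\<lambda>\<mu>. real DIM('a) * K \<mu>"
          and f = "\<lambda>\<mu> y. c \<mu> * monomial \<mu> (y - x)"])
      fix \<mu> and y h :: 'a assume y: "y \<in> ball x \<rho>"
      have "(monomial \<mu> \<circ> (\<lambda>y. y - x) has_derivative
          (\<lambda>h. \<Sum>b\<in>Basis. (h \<bullet> b) * monomial_partial b \<mu> (y - x)) \<circ> (\<lambda>h. h)) (at y within ball x \<rho>)"
        by (rule diff_chain_within[OF _ has_derivative_monomial]) (auto intro!: derivative_eq_intros)
      then have "((\<lambda>y. monomial \<mu> (y - x)) has_derivative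
          (\<lambda>h. \<Sum>b\<in>Basis. (h \<bullet> b) * monomial_partial b \<mu> (y - x))) (at y within ball x \<rho>)"
        by (simp add: o_def)
      then show "((\<lambda>y. c \<mu> * monomial \<mu> (y - x)) has_derivative f' \<mu> y) (at y within ball x \<rho>)"
        unfolding f'_def by (rule has_derivative_mult_right)
      have "\<bar>f' \<mu> y h\<bar> \<le> (\<Sum>b\<in>Basis. \<bar>(h \<bullet> b) * (c \<mu> * monomial_partial b \<mu> (y - x))\<bar>)"
        unfolding f'_def sum_distrib_left
        by (rule order_trans[OF sum_abs]) (simp add: mult_ac)
      also have "\<dots> \<le> (\<Sum>b\<in>(Basis::'a set). norm h * K \<mu>)"
        unfolding abs_mult[of "_ \<bullet> _"] by (intro sum_mono mult_mono Basis_le_norm le y) auto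
      finally show "\<bar>f' \<mu> y h\<bar> \<le> real DIM('a) * K \<mu> * norm h" by (simp add: mult_ac)
    next
      fix y assume "y \<in> ball x \<rho>"
      then show "((\<lambda>\<mu>. c \<mu> * monomial \<mu> (y - x)) has_sum f y) ?I"
        by (intro c) (auto simp: \<rho>_def)
    qed (use K in \<open>auto intro: summable_on_cmult_right\<close>)
    then show ?thesis using at_within_open[OF y] by simp
  qed
  show ?thesis
  proof
    show "\<rho> > 0" by (rule \<rho>)
    show "f differentiable (at y)" if "y \<in> ball x \<rho>" for y
      using der[OF that] differentiable_def by blast
    show "((\<lambda>\<mu>. c \<mu> * monomial_partial b \<mu> (y - x)) has_sum dir_deriv b f y) ?I"
      if "y \<in> ball x \<rho>" "b \<in> Basis" for y b
    proof -
      have "f' \<mu> y b = c \<mu> * monomial_partial b \<mu> (y - x)" for \<mu>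
        unfolding f'_def using that(2) by (simp add: inner_Basis if_distrib[of "\<lambda>x. x * _"] sum.delta cong: if_cong)
      then have "dir_deriv b f y = (\<Sum>\<^sub>\<infinity>\<mu>\<in>?I. c \<mu> * monomial_partial b \<mu> (y - x))"
        unfolding dir_deriv_def frechet_derivative_at[OF der[OF that(1)], symmetric] by simp
      then show ?thesis
        using has_sum_infsum[OF summ'[OF that]] by simp
    qed
  qed
qed

lemma real_analytic_imp_differentiable:
  "real_analytic f \<Longrightarrow> f differentiable (at x)"
  by (metis real_analytic_local_derivative centre_in_ball)

lemma real_analytic_dir_deriv:
  fixes f :: "'a::euclidean_space \<Rightarrow> real"
  assumes "real_analytic f" and b: "b \<in> Basis"
  shows "real_analytic (dir_deriv b f)"
  unfolding real_analytic_def
proof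
  let ?I = "Basis \<rightarrow>\<^sub>E UNIV :: ('a \<Rightarrow> nat) set"
  fix x
  obtain c \<rho> where \<rho>: "\<rho> > 0" and c: "\<And>y. y \<in> ball x \<rho> \<Longrightarrow>
       ((\<lambda>\<mu>. c \<mu> * monomial_partial b \<mu> (y - x)) has_sum dir_deriv b f y) ?I"
    using real_analytic_local_derivative[OF assms(1), of x] b by metis
  \<comment> \<open>The series of the derivative, re-indexed by lowering the exponent of b by
    one.\<close>
  define c' where "c' \<nu> = c (\<nu>(b := Suc (\<nu> b))) * real (Suc (\<nu> b))" for \<nu>
  have "((\<lambda>\<nu>. c' \<nu> * monomial \<nu> (y - x)) has_sum dir_deriv b f y) ?I" if y: "y \<in> ball x \<rho>" for y
  proof -
    \<comment> \<open>Indices with \<open>\<mu> b = 0\<close> contribute nothing; on the remaining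
      ones lowering the exponent is a bijection onto all multi-indices.\<close>
    have "((\<lambda>\<mu>. c \<mu> * monomial_partial b \<mu> (y - x)) has_sum dir_deriv b f y) {\<mu>\<in>?I. \<mu> b \<noteq> 0}"
      using c[OF y]
      by (subst has_sum_cong_neutral[where T = ?I and g = "\<lambda>\<mu>. c \<mu> * monomial_partial b \<mu> (y - x)"])
        (auto simp: monomial_partial_def)
    also have "?this \<longleftrightarrow> ?thesis"
      by (rule has_sum_reindex_bij_witness[where i = "\<lambda>\<nu>. \<nu>(b := Suc (\<nu> b))" and j = "\<lambda>\<mu>. \<mu>(b := \<mu> b - 1)"])
        (use b in \<open>auto simp: c'_def monomial_partial_def PiE_iff extensional_def\<close>)
    finally show ?thesis .
  qed
  then show "\<exists>c r. 0 < r \<and> (\<forall>y\<in>ball x r. ((\<lambda>\<mu>. c \<mu> * (\<Prod>b\<in>Basis. ((y - x) \<bullet> b) ^ \<mu> b)) has_sum dir_deriv b f y) ?I)"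
    using \<rho> unfolding monomial_def by blast
qed

section \<open>Taylor expansion along truncated power series\<close>

lemma partials_Nil [simp]: "partials [] f = f"
  and partials_Cons: "partials (b # w) f = dir_deriv b (partials w f)"
  by (simp_all add: partials_def)

text \<open>Phrased with the ordered words that occur in \<open>taylor_subst\<close>, so that
  partial derivatives taken in different orders never have to be identified.\<close>

definition smooth :: "('a::euclidean_space \<Rightarrow> real) \<Rightarrow> bool" where
  "smooth f \<longleftrightarrow> (\<forall>w x. set w \<subseteq> Basis \<longrightarrow> partials w f differentiable (at x))"

lemma real_analytic_imp_smooth:
  assumes "real_analytic f"
  shows "smooth f"
proof -
  have "real_analytic (partials w f)" if "set w \<subseteq> Basis" for w
    using that by (induction w) (auto simp: partials_Cons assms real_analytic_dir_deriv)
  then show ?thesis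
    unfolding smooth_def using real_analytic_imp_differentiable by blast
qed

lemma has_derivative_dir_deriv:
  fixes f :: "'a::euclidean_space \<Rightarrow> real"
  assumes "f differentiable (at x)"
  shows "(f has_derivative (\<lambda>h. \<Sum>b\<in>Basis. (h \<bullet> b) * dir_deriv b f x)) (at x)"
proof -
  have D: "(f has_derivative frechet_derivative f (at x)) (at x)"
    using assms frechet_derivative_works by blast
  then have lin: "linear (frechet_derivative f (at x))"
    by (simp add: has_derivative_linear)
  have "frechet_derivative f (at x) h = (\<Sum>b\<in>Basis. (h \<bullet> b) * dir_deriv b f x)" for h
  proof -
    have "frechet_derivative f (at x) h = frechet_derivative f (at x) (\<Sum>b\<in>Basis. (h \<bullet> b) *\<^sub>R b)"
      by (simp add: euclidean_representation)
    then show ?thesis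
      unfolding dir_deriv_def by (simp add: linear_sum[OF lin] linear_scale[OF lin])
  qed
  then show ?thesis using D by (metis (no_types, lifting) ext)
qed

lemma smooth_has_derivative:
  assumes "smooth f" "set w \<subseteq> Basis"
  shows "(partials w f has_derivative (\<lambda>h. \<Sum>b\<in>Basis. (h \<bullet> b) * partials (b # w) f x)) (at x)"
  using assms has_derivative_dir_deriv unfolding smooth_def partials_Cons by blast

lemma smooth_continuous_on:
  assumes "smooth f" "set w \<subseteq> Basis"
  shows "continuous_on S (partials w f)"
  by (intro continuous_at_imp_continuous_on ballI has_derivative_continuous[OF smooth_has_derivative[OF assms]])

section \<open>Taylor's formula in several variables, summed over words of directions\<close>

definition words :: "nat \<Rightarrow> 'a::euclidean_space list set" where
  "words j = {w. set w \<subseteq> Basis \<and> length w = j}"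

lemma finite_words [simp]: "finite (words j)"
  unfolding words_def by (rule finite_lists_length_eq) simp

lemma words_0 [simp]: "words 0 = {[]}"
  by (auto simp: words_def)

lemma sum_words_Suc:
  "(\<Sum>w\<in>words (Suc j). g w) = (\<Sum>b\<in>Basis. \<Sum>w\<in>words j. g (b # w))"
proof -
  have "(\<Sum>w\<in>words (Suc j). g w) = (\<Sum>(b, w)\<in>Basis \<times> words j. g (b # w))"
    by (rule sum.reindex_bij_witness[where i = "\<lambda>(b, w). b # w" and j = "\<lambda>w. (hd w, tl w)"])
      (auto simp: words_def length_Suc_conv)
  then show ?thesis by (simp add: sum.cartesian_product)
qed

text \<open>The j-th derivative of f at x on the diagonal (h, ..., h). Summing over words instead of
  multi-indices leaves 1/j! as the only factor in Taylor's formula.\<close>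

definition differential :: "('a::euclidean_space \<Rightarrow> real) \<Rightarrow> nat \<Rightarrow> 'a \<Rightarrow> 'a \<Rightarrow> real" where
  "differential f j x h = (\<Sum>w\<in>words j. partials w f x * prod_list (map ((\<bullet>) h) w))"

text \<open>The chain rule prepends one more direction to each word. Hence these functions are the
  successive derivatives of t \<mapsto> f(x + th), and Taylor's formula in one variable becomes
  available.\<close>

lemma differential_has_field_derivative:
  assumes "smooth f"
  shows "((\<lambda>t. differential f j (x + t *\<^sub>R h) h) has_field_derivative
           differential f (Suc j) (x + t *\<^sub>R h) h) (at t)"
proof -
  have D: "((\<lambda>t. partials w f (x + t *\<^sub>R h)) has_field_derivative
      (\<Sum>b\<in>Basis. (h \<bullet> b) * partials (b # w) f (x + t *\<^sub>R h))) (at t)" if "w \<in> words j" for w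
  proof -
    have "(partials w f \<circ> (\<lambda>t. x + t *\<^sub>R h) has_derivative
        (\<lambda>k. \<Sum>b\<in>Basis. (k \<bullet> b) * partials (b # w) f (x + t *\<^sub>R h)) \<circ> (\<lambda>s. s *\<^sub>R h)) (at t)"
      by (rule diff_chain_at[OF _ smooth_has_derivative[OF assms]])
        (use that in \<open>auto intro!: derivative_eq_intros simp: words_def\<close>)
    then show ?thesis
      unfolding has_field_derivative_def o_def
      by (rule has_derivative_eq_rhs) (auto simp: fun_eq_iff sum_distrib_left sum_distrib_right mult_ac)
  qed
  show ?thesis
    unfolding differential_def[of f j]
    by (rule DERIV_cong[OF DERIV_sum[OF DERIV_cmult_right[OF D]]])
      (assumption, simp add: differential_def sum_words_Suc sum_distrib_left sum_distrib_right mult_ac,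
        subst sum.swap, rule refl)
qed

lemma abs_prod_list_inner_le:
  assumes "w \<in> words j"
  shows "\<bar>prod_list (map ((\<bullet>) h) w)\<bar> \<le> norm h ^ j"
proof -
  have "set w \<subseteq> Basis" using assms by (simp add: words_def)
  then have "\<bar>prod_list (map ((\<bullet>) h) w)\<bar> \<le> norm h ^ length w"
    by (induction w) (auto simp: abs_mult intro!: mult_mono Basis_le_norm)
  then show ?thesis using assms by (simp add: words_def)
qed

lemma smooth_partials_bounded:
  fixes f :: "'a::euclidean_space \<Rightarrow> real"
  assumes "smooth f"
  obtains M where "M \<ge> 0" "\<And>w x. w \<in> words j \<Longrightarrow> norm x \<le> R \<Longrightarrow> \<bar>partials w f x\<bar> \<le> M"
proof -
  have "\<exists>M\<ge>0. \<forall>x. norm x \<le> R \<longrightarrow> \<bar>partials w f x\<bar> \<le> M" if "w \<in> words j" for w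
  proof -
    have "continuous_on (cball 0 R) (partials w f)"
      using smooth_continuous_on[OF assms] that by (simp add: words_def)
    then have "bounded (partials w f ` cball 0 R)"
      using compact_cball compact_continuous_image compact_imp_bounded by blast
    then obtain M where "M > 0" "\<And>x. x \<in> cball 0 R \<Longrightarrow> \<bar>partials w f x\<bar> \<le> M"
      unfolding bounded_pos by auto
    then show ?thesis by (intro exI[of _ M]) auto
  qed
  then obtain M where M: "\<And>w. w \<in> words j \<Longrightarrow> M w \<ge> 0"
    "\<And>w x. w \<in> words j \<Longrightarrow> norm x \<le> R \<Longrightarrow> \<bar>partials w f x\<bar> \<le> M w" by metis
  show ?thesis
  proof
    show "0 \<le> (\<Sum>w\<in>words j. M w)" by (rule sum_nonneg) (rule M)
    show "\<bar>partials w f x\<bar> \<le> (\<Sum>w\<in>words j. M w)" if "w \<in> words j" "norm x \<le> R" for w x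
      using M(2)[OF that] member_le_sum[OF that(1), of M] M(1) by fastforce
  qed
qed

text \<open>Lagrange's remainder on the line through x in direction h. The intermediate point lies
  in the ball of radius 2R, where compactness bounds the n-th partials; so C depends on neither x
  nor h.\<close>

lemma multivariate_taylor:
  fixes f :: "'a::euclidean_space \<Rightarrow> real"
  assumes "smooth f"
  obtains C where "C \<ge> 0" "\<And>x h. norm x \<le> R \<Longrightarrow> norm h \<le> R \<Longrightarrow>
    \<bar>f (x + h) - (\<Sum>j<n. differential f j x h / fact j)\<bar> \<le> C * norm h ^ n"
proof -
  obtain M where M: "M \<ge> 0" "\<And>w x. w \<in> words n \<Longrightarrow> norm x \<le> R + R \<Longrightarrow> \<bar>partials w f x\<bar> \<le> M"
    using smooth_partials_bounded[OF assms] by metis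
  define C where "C = real (card (words n :: 'a list set)) * M / fact n"
  show ?thesis
  proof
    show "C \<ge> 0" using M(1) by (simp add: C_def)
    fix x h :: 'a assume x: "norm x \<le> R" and h: "norm h \<le> R"
    define diff where "diff j t = differential f j (x + t *\<^sub>R h) h" for j t
    have "\<exists>t::real. \<bar>t\<bar> \<le> \<bar>1\<bar> \<and> diff 0 1 = (\<Sum>m<n. diff m 0 / fact m * 1 ^ m) + diff n t / fact n * 1 ^ n"
      by (rule Maclaurin_all_le) (auto simp: diff_def differential_has_field_derivative[OF assms])
    then obtain t where t: "\<bar>t\<bar> \<le> 1" "diff 0 1 = (\<Sum>m<n. diff m 0 / fact m) + diff n t / fact n"
      by auto
    have "norm (t *\<^sub>R h) \<le> 1 * R" unfolding norm_scaleR by (intro mult_mono t h) (use t in auto)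
    then have xt: "norm (x + t *\<^sub>R h) \<le> R + R"
      using x norm_triangle_ineq[of x "t *\<^sub>R h"] by linarith
    have "\<bar>diff n t\<bar> \<le> (\<Sum>w\<in>(words n :: 'a list set). M * norm h ^ n)"
      unfolding diff_def differential_def
      by (rule order_trans[OF sum_abs], unfold abs_mult)
        (intro sum_mono mult_mono M xt abs_prod_list_inner_le; simp)
    also have "\<dots> = C * norm h ^ n * fact n" by (simp add: C_def)
    finally have "\<bar>diff n t / fact n\<bar> \<le> C * norm h ^ n"
      by (simp add: divide_le_eq)
    moreover have "diff 0 1 = f (x + h)" by (simp add: diff_def differential_def)
    ultimately show "\<bar>f (x + h) - (\<Sum>j<n. differential f j x h / fact j)\<bar> \<le> C * norm h ^ n"
      using t(2) by (simp add: diff_def)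
  qed
qed

section \<open>Truncated series as functions of t, and their products\<close>

definition fps_partial_sum :: "nat \<Rightarrow> 'a::real_vector fps \<Rightarrow> real \<Rightarrow> 'a" where
  "fps_partial_sum N X t = (\<Sum>n\<le>N. t ^ n *\<^sub>R fps_nth X n)"

lemma abs_fps_partial_sum_le:
  fixes X :: "'a::real_normed_vector fps" and A :: real
  assumes "\<And>n. n \<le> N \<Longrightarrow> norm (fps_nth X n) \<le> A" "\<bar>t\<bar> \<le> 1"
  shows "norm (fps_partial_sum N X t) \<le> (N + 1) * A"
proof -
  have "norm (fps_partial_sum N X t) \<le> (\<Sum>n\<le>N. A)"
    unfolding fps_partial_sum_def
  proof (rule sum_norm_le)
    fix n assume "n \<in> {..N}"
    then have "norm (t ^ n *\<^sub>R fps_nth X n) \<le> 1 * A"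
      unfolding norm_scaleR using assms
      by (intro mult_mono) (auto simp: power_abs power_le_one)
    then show "norm (t ^ n *\<^sub>R fps_nth X n) \<le> A" by simp
  qed
  then show ?thesis by (simp add: algebra_simps)
qed

lemma fps_mult_nth_le:
  fixes p q :: "real fps" and A B :: real and N :: nat
  assumes "\<And>n. n \<le> N \<Longrightarrow> \<bar>fps_nth p n\<bar> \<le> A" "\<And>n. n \<le> N \<Longrightarrow> \<bar>fps_nth q n\<bar> \<le> B" "n \<le> N"
  shows "\<bar>fps_nth (p * q) n\<bar> \<le> (N + 1) * (A * B)"
proof -
  have AB: "A \<ge> 0" "B \<ge> 0" using order_trans[OF abs_ge_zero assms(1)[of 0]] order_trans[OF abs_ge_zero assms(2)[of 0]] by auto
  have "\<bar>fps_nth (p * q) n\<bar> \<le> (\<Sum>i=0..n. A * B)"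
    unfolding fps_mult_nth
    by (rule order_trans[OF sum_abs], unfold abs_mult) (intro sum_mono mult_mono assms AB; use assms in auto)
  also have "\<dots> \<le> (N + 1) * (A * B)" using assms(3) AB by (simp add: mult_right_mono)
  finally show ?thesis .
qed

text \<open>The product of the truncations runs over the index square, the truncated product over
  the triangle i + j \<le> N. The difference has at most (N+1)^2 terms, each of degree at least
  N+1.\<close>

lemma fps_partial_sum_mult:
  fixes p q :: "real fps"
  assumes p: "\<And>n. n \<le> N \<Longrightarrow> \<bar>fps_nth p n\<bar> \<le> A" and q: "\<And>n. n \<le> N \<Longrightarrow> \<bar>fps_nth q n\<bar> \<le> B"
    and t: "\<bar>t\<bar> \<le> 1"
  shows "\<bar>fps_partial_sum N p t * fps_partial_sum N q t - fps_partial_sum N (p * q) t\<bar>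
           \<le> (real N + 1)\<^sup>2 * (A * B) * \<bar>t\<bar> ^ (N + 1)"
proof -
  have AB: "A \<ge> 0" "B \<ge> 0" using order_trans[OF abs_ge_zero p[of 0]] order_trans[OF abs_ge_zero q[of 0]] by auto
  define g where "g = (\<lambda>(i, j). t ^ (i + j) * (fps_nth p i * fps_nth q j))"
  define S where "S = {..N} \<times> {..N}"
  define T where "T = {(i, j). i + j \<le> N}"
  have T: "T \<subseteq> S" "finite S" by (auto simp: S_def T_def)
  have 1: "fps_partial_sum N p t * fps_partial_sum N q t = sum g S"
    unfolding fps_partial_sum_def sum_product S_def sum.cartesian_product g_def
    by (intro sum.cong) (auto simp: power_add mult_ac)
  have "fps_partial_sum N (p * q) t = (\<Sum>n\<le>N. \<Sum>i\<le>n. g (i, n - i))"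
    unfolding fps_partial_sum_def fps_mult_nth g_def
    by (intro sum.cong) (auto simp: sum_distrib_left atLeast0AtMost)
  also have "\<dots> = sum g T"
    using sum.triangle_reindex_eq[of "\<lambda>i j. g (i, j)" N] by (simp add: T_def case_prod_unfold)
  finally have 2: "fps_partial_sum N (p * q) t = sum g T" .
  have "\<bar>sum g S - sum g T\<bar> = \<bar>sum g (S - T)\<bar>"
    using T by (simp add: sum_diff)
  also have "\<dots> \<le> (\<Sum>x\<in>S - T. A * B * \<bar>t\<bar> ^ (N + 1))"
  proof (rule order_trans[OF sum_abs], rule sum_mono)
    fix x assume x: "x \<in> S - T"
    then obtain i j where ij: "x = (i, j)" "i \<le> N" "j \<le> N" "N + 1 \<le> i + j"
      by (auto simp: S_def T_def)
    have "\<bar>t\<bar> ^ (i + j) * (\<bar>fps_nth p i\<bar> * \<bar>fps_nth q j\<bar>) \<le> \<bar>t\<bar> ^ (N + 1) * (A * B)"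
      by (intro mult_mono power_decreasing p q ij t) (use AB in auto)
    then show "\<bar>g x\<bar> \<le> A * B * \<bar>t\<bar> ^ (N + 1)"
      by (simp add: g_def ij abs_mult power_abs mult_ac)
  qed
  also have "\<dots> = card (S - T) * (A * B * \<bar>t\<bar> ^ (N + 1))" by simp
  also have "\<dots> \<le> (N + 1)\<^sup>2 * (A * B * \<bar>t\<bar> ^ (N + 1))"
  proof (rule mult_right_mono)
    have "card (S - T) \<le> card S" by (rule card_mono) (auto simp: T)
    also have "card S = (N + 1)\<^sup>2" by (simp add: S_def card_cartesian_product power2_eq_square)
    finally show "real (card (S - T)) \<le> real ((N + 1)\<^sup>2)" by (rule of_nat_mono)
  qed (use AB in auto)
  finally show ?thesis by (simp add: 1 2 mult_ac add_ac)
qed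

text \<open>B and C are chosen before the list, hence uniform over all lists of length j with
  coefficients bounded by A. The coefficient bound B is carried along because the induction step
  multiplies by the product already formed.\<close>

lemma fps_partial_sum_prod_list:
  assumes A: "A \<ge> 0"
  shows "\<exists>B C. B \<ge> 0 \<and> C \<ge> 0 \<and> (\<forall>ps :: real fps list.
    length ps = j \<longrightarrow> (\<forall>p\<in>set ps. \<forall>n\<le>N. \<bar>fps_nth p n\<bar> \<le> A) \<longrightarrow>
    (\<forall>n\<le>N. \<bar>fps_nth (prod_list ps) n\<bar> \<le> B) \<and>
    (\<forall>t. \<bar>t\<bar> \<le> 1 \<longrightarrow> \<bar>prod_list (map (\<lambda>p. fps_partial_sum N p t) ps) - fps_partial_sum N (prod_list ps) t\<bar>
       \<le> C * \<bar>t\<bar> ^ (N + 1)))"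
proof (induction j)
  case 0
  have "fps_partial_sum N (1 :: real fps) t = 1" for t
    unfolding fps_partial_sum_def by (simp add: fps_one_nth if_distrib cong: if_cong)
  then show ?case
    by (intro exI[of _ 1] exI[of _ 0]) (auto simp: fps_one_nth)
next
  case (Suc j)
  then obtain B C where BC: "B \<ge> 0" "C \<ge> 0" and
    IH1: "\<And>ps n. length ps = j \<Longrightarrow> (\<forall>p\<in>set ps. \<forall>n\<le>N. \<bar>fps_nth p n\<bar> \<le> A) \<Longrightarrow> n \<le> N \<Longrightarrow>
      \<bar>fps_nth (prod_list ps) n\<bar> \<le> B" and
    IH2: "\<And>ps t. length ps = j \<Longrightarrow> (\<forall>p\<in>set ps. \<forall>n\<le>N. \<bar>fps_nth p n\<bar> \<le> A) \<Longrightarrow> \<bar>t\<bar> \<le> 1 \<Longrightarrow>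
      \<bar>prod_list (map (\<lambda>p. fps_partial_sum N p t) ps) - fps_partial_sum N (prod_list ps) t\<bar> \<le> C * \<bar>t\<bar> ^ (N + 1)"
    by metis
  define B' where "B' = (N + 1) * (A * B)"
  \<comment> \<open>The first summand is the earlier error multiplied by the new factor, which is at
    most (N+1)A; the second is the error of truncating one more product.\<close>
  define C' where "C' = (real N + 1) * A * C + (real N + 1)\<^sup>2 * (A * B)"
  show ?case
  proof (rule exI[of _ B'], rule exI[of _ C'], intro conjI allI impI)
    show "B' \<ge> 0" "C' \<ge> 0" using A BC by (auto simp: B'_def C'_def)
  next
    fix ps :: "real fps list" and n
    assume ps: "length ps = Suc j" "\<forall>p\<in>set ps. \<forall>n\<le>N. \<bar>fps_nth p n\<bar> \<le> A" and n: "n \<le> N"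
    obtain p qs where [simp]: "ps = p # qs" "length qs = j" using ps(1) by (auto simp: length_Suc_conv)
    show "\<bar>fps_nth (prod_list ps) n\<bar> \<le> B'"
      unfolding B'_def by (simp, rule order_trans[OF fps_mult_nth_le[where A=A and B=B and N=N]]) (use ps n IH1[of qs] in auto)
  next
    fix ps :: "real fps list" and t :: real
    assume ps: "length ps = Suc j" "\<forall>p\<in>set ps. \<forall>n\<le>N. \<bar>fps_nth p n\<bar> \<le> A" and t: "\<bar>t\<bar> \<le> 1"
    obtain p qs where [simp]: "ps = p # qs" "length qs = j" using ps(1) by (auto simp: length_Suc_conv)
    have p: "\<And>n. n \<le> N \<Longrightarrow> \<bar>fps_nth p n\<bar> \<le> A" and qs: "\<forall>q\<in>set qs. \<forall>n\<le>N. \<bar>fps_nth q n\<bar> \<le> A"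
      using ps by auto
    define P Q Q' where "P = fps_partial_sum N p t"
      and "Q = prod_list (map (\<lambda>p. fps_partial_sum N p t) qs)"
      and "Q' = fps_partial_sum N (prod_list qs) t"
    have "\<bar>P\<bar> \<le> (N + 1) * A"
      using abs_fps_partial_sum_le[of N p A t] p t by (simp add: P_def add.commute)
    then have "\<bar>P\<bar> * \<bar>Q - Q'\<bar> \<le> ((N + 1) * A) * (C * \<bar>t\<bar> ^ (N + 1))"
      unfolding Q_def Q'_def by (intro mult_mono IH2 qs t) (use A in auto)
    moreover have "\<bar>P * Q' - fps_partial_sum N (p * prod_list qs) t\<bar> \<le> (real N + 1)\<^sup>2 * (A * B) * \<bar>t\<bar> ^ (N + 1)"
      unfolding P_def Q'_def by (rule fps_partial_sum_mult) (use p qs t IH1[of qs] in auto)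
    moreover have "\<bar>P * Q - fps_partial_sum N (p * prod_list qs) t\<bar>
        \<le> \<bar>P\<bar> * \<bar>Q - Q'\<bar> + \<bar>P * Q' - fps_partial_sum N (p * prod_list qs) t\<bar>"
      unfolding abs_mult[symmetric] right_diff_distrib by linarith
    ultimately show "\<bar>prod_list (map (\<lambda>p. fps_partial_sum N p t) ps) - fps_partial_sum N (prod_list ps) t\<bar>
        \<le> C' * \<bar>t\<bar> ^ (N + 1)"
      by (simp add: P_def[symmetric] Q_def[symmetric] C'_def algebra_simps)
  qed
qed

text \<open>Each factor has order at least 1, so the product has order at least
  \<open>length ps\<close>. This lets the range j \<le> n in \<open>taylor_subst\<close> be enlarged
  to the common range j \<le> N.\<close>

lemma prod_list_fps_nth_eq_0:
  fixes ps :: "real fps list"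
  assumes "\<And>p. p \<in> set ps \<Longrightarrow> fps_nth p 0 = 0" "n < length ps"
  shows "fps_nth (prod_list ps) n = 0"
  using assms
proof (induction ps arbitrary: n)
  case (Cons p ps)
  have "fps_nth p i * fps_nth (prod_list ps) (n - i) = 0" if "i \<le> n" for i
    using Cons that by (cases "i = 0") auto
  then show ?case by (simp add: fps_mult_nth sum.neutral)
qed simp

section \<open>Formal substitution compared with evaluation at truncations\<close>

definition increment :: "'a::euclidean_space fps \<Rightarrow> 'a \<Rightarrow> real fps" where
  "increment X b = Abs_fps (\<lambda>m. fps_nth (X - fps_const (fps_nth X 0)) m \<bullet> b)"

lemma increment_nth: "fps_nth (increment X b) m = (if m = 0 then 0 else fps_nth X m \<bullet> b)"
  by (simp add: increment_def)

lemma taylor_subst_nth: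
  "fps_nth (taylor_subst f X) n = (\<Sum>j\<le>n. \<Sum>w\<in>words j.
     partials w f (fps_nth X 0) / fact j * fps_nth (prod_list (map (increment X) w)) n)"
  unfolding taylor_subst_def words_def increment_def[abs_def] by (simp add: Let_def)

lemma taylor_subst_nth_0 [simp]: "fps_nth (taylor_subst f X) 0 = f (fps_nth X 0)"
  by (simp add: taylor_subst_nth)

text \<open>Taylor's formula at the constant term of X: the increment is O(t), so a remainder of
  degree N+1 in it has the required size. What is left is the exchange of products of truncations
  for truncations of products. C precedes X because X itself will later vary with t.\<close>

lemma taylor_subst_approx:
  fixes f :: "'a::euclidean_space \<Rightarrow> real"
  assumes f: "smooth f" and R: "R \<ge> 0"
  obtains C where "C \<ge> 0" "\<And>X t. (\<And>n. n \<le> N \<Longrightarrow> norm (fps_nth X n) \<le> R) \<Longrightarrow> \<bar>t\<bar> \<le> 1 \<Longrightarrow>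
    \<bar>f (fps_partial_sum N X t) - fps_partial_sum N (taylor_subst f X) t\<bar> \<le> C * \<bar>t\<bar> ^ (N + 1)"
proof -
  obtain C1 where C1: "C1 \<ge> 0" "\<And>x h. norm x \<le> (N + 1) * R \<Longrightarrow> norm h \<le> (N + 1) * R \<Longrightarrow>
    \<bar>f (x + h) - (\<Sum>j<Suc N. differential f j x h / fact j)\<bar> \<le> C1 * norm h ^ Suc N"
    using multivariate_taylor[OF f] by blast
  have "\<exists>M\<ge>0. \<forall>w x. w \<in> words j \<longrightarrow> norm x \<le> R \<longrightarrow> \<bar>partials w f x\<bar> \<le> M" for j
    using smooth_partials_bounded[OF f] by metis
  then obtain M where M: "\<And>j. M j \<ge> 0" "\<And>j w x. w \<in> words j \<Longrightarrow> norm x \<le> R \<Longrightarrow> \<bar>partials w f x\<bar> \<le> M j"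
    by metis
  have "\<exists>D\<ge>0. \<forall>ps :: real fps list. length ps = j \<longrightarrow> (\<forall>p\<in>set ps. \<forall>n\<le>N. \<bar>fps_nth p n\<bar> \<le> R) \<longrightarrow>
    (\<forall>t. \<bar>t\<bar> \<le> 1 \<longrightarrow> \<bar>prod_list (map (\<lambda>p. fps_partial_sum N p t) ps) - fps_partial_sum N (prod_list ps) t\<bar>
       \<le> D * \<bar>t\<bar> ^ (N + 1))" for j
    using fps_partial_sum_prod_list[OF R, of j N] by meson
  then obtain D where D: "\<And>j. D j \<ge> 0" "\<And>j (ps :: real fps list) t. length ps = j \<Longrightarrow>
      (\<And>p n. p \<in> set ps \<Longrightarrow> n \<le> N \<Longrightarrow> \<bar>fps_nth p n\<bar> \<le> R) \<Longrightarrow> \<bar>t\<bar> \<le> 1 \<Longrightarrow>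
      \<bar>prod_list (map (\<lambda>p. fps_partial_sum N p t) ps) - fps_partial_sum N (prod_list ps) t\<bar> \<le> D j * \<bar>t\<bar> ^ (N + 1)"
    by metis
  \<comment> \<open>Truncation errors D of the products, weighted with the bounds M of the Taylor
    coefficients.\<close>
  define C2 where "C2 = (\<Sum>j\<le>N. \<Sum>w\<in>(words j :: 'a list set). M j / fact j * D j)"
  show ?thesis
  proof
    show "C1 * ((N + 1) * R) ^ (N + 1) + C2 \<ge> 0"
      using C1(1) M(1) D(1) R unfolding C2_def by (intro add_nonneg_nonneg sum_nonneg) auto
    fix X :: "'a fps" and t :: real
    assume X: "\<And>n. n \<le> N \<Longrightarrow> norm (fps_nth X n) \<le> R" and t: "\<bar>t\<bar> \<le> 1"
    define x0 where "x0 = fps_nth X 0"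
    define h where "h = fps_partial_sum N X t - x0"
    have x0h: "x0 + h = fps_partial_sum N X t" by (simp add: h_def)
    have x0: "norm x0 \<le> R" unfolding x0_def by (rule X) simp
    also have "R \<le> (N + 1) * R" using R by (simp add: algebra_simps)
    finally have x0': "norm x0 \<le> (N + 1) * R" .
    \<comment> \<open>Without the constant term every summand contains a factor t; this is the
      source of the power of t in the remainder.\<close>
    have "h = (\<Sum>n\<in>{1..N}. t ^ n *\<^sub>R fps_nth X n)"
      unfolding h_def fps_partial_sum_def x0_def
      by (simp add: atMost_atLeast0 sum.atLeast_Suc_atMost)
    also have "norm \<dots> \<le> (\<Sum>n\<in>{1..N}. \<bar>t\<bar> * R)"
    proof (rule sum_norm_le)
      fix n assume n: "n \<in> {1..N}"
      have "\<bar>t\<bar> ^ n \<le> \<bar>t\<bar> ^ 1" using n t by (intro power_decreasing) auto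
      then show "norm (t ^ n *\<^sub>R fps_nth X n) \<le> \<bar>t\<bar> * R"
        unfolding norm_scaleR using n by (intro mult_mono X) (auto simp: power_abs)
    qed
    also have "\<dots> = \<bar>t\<bar> * (N * R)" by simp
    also have "\<dots> \<le> \<bar>t\<bar> * ((N + 1) * R)" using R by (intro mult_left_mono mult_right_mono) auto
    finally have h: "norm h \<le> \<bar>t\<bar> * ((N + 1) * R)" .
    also have "\<dots> \<le> 1 * ((N + 1) * R)" by (intro mult_right_mono t) (use R in auto)
    finally have h': "norm h \<le> (N + 1) * R" by simp
    have "\<bar>f (x0 + h) - (\<Sum>j<Suc N. differential f j x0 h / fact j)\<bar> \<le> C1 * norm h ^ Suc N"
      by (rule C1(2)[OF x0' h'])
    also have "\<dots> \<le> C1 * (\<bar>t\<bar> * ((N + 1) * R)) ^ Suc N"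
      by (intro mult_left_mono power_mono h C1) auto
    finally have E1: "\<bar>f (x0 + h) - (\<Sum>j\<le>N. differential f j x0 h / fact j)\<bar>
        \<le> C1 * ((N + 1) * R) ^ (N + 1) * \<bar>t\<bar> ^ (N + 1)"
      by (simp add: lessThan_Suc_atMost power_mult_distrib mult_ac)
    have inc: "fps_partial_sum N (increment X b) t = h \<bullet> b" for b
      unfolding fps_partial_sum_def increment_nth \<open>h = (\<Sum>n\<in>{1..N}. t ^ n *\<^sub>R fps_nth X n)\<close>
      by (simp add: atMost_atLeast0 sum.atLeast_Suc_atMost inner_sum_left)
    have "fps_partial_sum N (taylor_subst f X) t = (\<Sum>n\<le>N. \<Sum>j\<le>N. \<Sum>w\<in>words j.
        t ^ n * (partials w f x0 / fact j * fps_nth (prod_list (map (increment X) w)) n))"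
      unfolding fps_partial_sum_def
    proof (rule sum.cong[OF refl])
      fix n assume "n \<in> {..N}"
      then have "fps_nth (taylor_subst f X) n = (\<Sum>j\<le>N. \<Sum>w\<in>words j.
          partials w f x0 / fact j * fps_nth (prod_list (map (increment X) w)) n)"
        unfolding taylor_subst_nth x0_def
        by (intro sum.mono_neutral_left)
          (auto intro!: sum.neutral prod_list_fps_nth_eq_0 simp: increment_nth words_def)
      then show "t ^ n *\<^sub>R fps_nth (taylor_subst f X) n = (\<Sum>j\<le>N. \<Sum>w\<in>words j.
        t ^ n * (partials w f x0 / fact j * fps_nth (prod_list (map (increment X) w)) n))"
        by (simp add: sum_distrib_left)
    qed
    also have "\<dots> = (\<Sum>j\<le>N. \<Sum>w\<in>words j. \<Sum>n\<le>N.
        t ^ n * (partials w f x0 / fact j * fps_nth (prod_list (map (increment X) w)) n))"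
      by (subst sum.swap, subst sum.swap) (rule refl)
    also have "\<dots> = (\<Sum>j\<le>N. \<Sum>w\<in>words j. partials w f x0 / fact j *
        fps_partial_sum N (prod_list (map (increment X) w)) t)"
      unfolding fps_partial_sum_def by (simp add: sum_distrib_left mult_ac)
    finally have ts: "fps_partial_sum N (taylor_subst f X) t = (\<Sum>j\<le>N. \<Sum>w\<in>words j. partials w f x0 / fact j *
        fps_partial_sum N (prod_list (map (increment X) w)) t)" .
    have "(\<Sum>j\<le>N. differential f j x0 h / fact j) - fps_partial_sum N (taylor_subst f X) t =
      (\<Sum>j\<le>N. \<Sum>w\<in>words j. partials w f x0 / fact j *
        (prod_list (map (\<lambda>p. fps_partial_sum N p t) (map (increment X) w))
          - fps_partial_sum N (prod_list (map (increment X) w)) t))"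
      unfolding ts differential_def right_diff_distrib map_map o_def inc
      by (simp add: sum_divide_distrib sum_subtractf)
    also have "\<bar>\<dots>\<bar> \<le> (\<Sum>j\<le>N. \<Sum>w\<in>(words j :: 'a list set). M j / fact j * (D j * \<bar>t\<bar> ^ (N + 1)))"
    proof (rule order_trans[OF sum_abs], rule sum_mono, rule order_trans[OF sum_abs], rule sum_mono)
      fix j and w :: "'a list" assume w: "w \<in> words j"
      have "\<bar>fps_nth (increment X b) n\<bar> \<le> R" if "b \<in> Basis" "n \<le> N" for b n
        using Basis_le_norm[OF that(1), of "fps_nth X n"] X[OF that(2)] R by (simp add: increment_nth)
      then have "\<bar>prod_list (map (\<lambda>p. fps_partial_sum N p t) (map (increment X) w))
          - fps_partial_sum N (prod_list (map (increment X) w)) t\<bar> \<le> D j * \<bar>t\<bar> ^ (N + 1)"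
        using w by (intro D(2) t) (auto simp: words_def)
      then show "\<bar>partials w f x0 / fact j *
        (prod_list (map (\<lambda>p. fps_partial_sum N p t) (map (increment X) w))
          - fps_partial_sum N (prod_list (map (increment X) w)) t)\<bar> \<le> M j / fact j * (D j * \<bar>t\<bar> ^ (N + 1))"
        unfolding abs_mult abs_divide
        by (intro mult_mono divide_mono M(2) w x0) (use M(1) in auto)
    qed
    also have "\<dots> = C2 * \<bar>t\<bar> ^ (N + 1)"
      unfolding C2_def sum_distrib_right by (simp add: mult_ac)
    finally show "\<bar>f (fps_partial_sum N X t) - fps_partial_sum N (taylor_subst f X) t\<bar>
        \<le> (C1 * ((N + 1) * R) ^ (N + 1) + C2) * \<bar>t\<bar> ^ (N + 1)"
      using E1 unfolding x0h distrib_right[of "C1 * _"] by linarith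
  qed
qed

text \<open>Letting t tend to 0 from the right gives a(0) = 0; then the estimate can be divided by
  t, which lowers N by one.\<close>

lemma polynomial_coeffs_0_if_small:
  fixes a :: "nat \<Rightarrow> real"
  assumes "\<And>t. 0 < t \<Longrightarrow> t \<le> 1 \<Longrightarrow> \<bar>\<Sum>n\<le>N. t ^ n * a n\<bar> \<le> C * t ^ (N + 1)" and "n \<le> N"
  shows "a n = 0"
  using assms
proof (induction N arbitrary: a n)
  case (0 a n)
  have "((\<lambda>t. C * t - \<bar>a 0\<bar>) \<longlongrightarrow> C * 0 - \<bar>a 0\<bar>) (at_right 0)"
    by (intro tendsto_intros)
  moreover have "\<forall>\<^sub>F t in at_right 0. 0 \<le> C * t - \<bar>a 0\<bar>"
    unfolding eventually_at_right_field using 0(1) by (intro exI[of _ 1]) auto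
  ultimately have "0 \<le> C * 0 - \<bar>a 0\<bar>"
    by (rule tendsto_lowerbound) simp
  then show ?case using 0(2) by simp
next
  case (Suc N a n)
  have "((\<lambda>t. C * t ^ (Suc N + 1) - \<bar>\<Sum>n\<le>Suc N. t ^ n * a n\<bar>) \<longlongrightarrow>
      C * 0 ^ (Suc N + 1) - \<bar>\<Sum>n\<le>Suc N. 0 ^ n * a n\<bar>) (at_right 0)"
    by (intro tendsto_intros)
  moreover have "\<forall>\<^sub>F t in at_right 0. 0 \<le> C * t ^ (Suc N + 1) - \<bar>\<Sum>n\<le>Suc N. t ^ n * a n\<bar>"
    unfolding eventually_at_right_field using Suc.prems(1) by (intro exI[of _ 1]) auto
  ultimately have "0 \<le> C * 0 ^ (Suc N + 1) - \<bar>\<Sum>n\<le>Suc N. 0 ^ n * a n\<bar>"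
    by (rule tendsto_lowerbound) simp
  moreover have "(\<Sum>n\<le>Suc N. 0 ^ n * a n) = a 0"
    by (simp only: sum.atMost_Suc_shift) simp
  ultimately have a0: "a 0 = 0" by simp
  have "a (Suc m) = 0" if "m \<le> N" for m
  proof (rule Suc.IH[OF _ that])
    fix t :: real assume t: "0 < t" "t \<le> 1"
    have "(\<Sum>n\<le>Suc N. t ^ n * a n) = t * (\<Sum>n\<le>N. t ^ n * a (Suc n))"
      by (simp only: sum.atMost_Suc_shift a0) (simp add: sum_distrib_left mult_ac)
    then have "t * \<bar>\<Sum>n\<le>N. t ^ n * a (Suc n)\<bar> \<le> t * (C * t ^ (N + 1))"
      using Suc.prems(1)[OF t] t by (simp add: abs_mult mult_ac)
    then show "\<bar>\<Sum>n\<le>N. t ^ n * a (Suc n)\<bar> \<le> C * t ^ (N + 1)"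
      using t by (simp del: power_Suc)
  qed
  then show ?case using a0 Suc.prems(2) by (cases n) auto
qed

section \<open>Periodic functions\<close>

lemma torus_fun_add_int:
  assumes "torus_fun f" "b \<in> Basis"
  shows "f (x + of_int k *\<^sub>R b) = f x"
proof -
  have nat: "f (x + of_nat n *\<^sub>R b) = f x" for x n
  proof (induction n)
    case (Suc n)
    have "f (x + of_nat (Suc n) *\<^sub>R b) = f ((x + of_nat n *\<^sub>R b) + b)"
      by (simp add: algebra_simps)
    then show ?case using assms Suc by (simp add: torus_fun_def)
  qed simp
  show ?thesis
  proof (cases "k \<ge> 0")
    case True
    then show ?thesis using nat[of x "nat k"] by simp
  next
    case False
    then show ?thesis using nat[of "x + of_int k *\<^sub>R b" "nat (- k)"] by simp
  qed
qed

lemma torus_fun_add_int_sum: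
  assumes "torus_fun f" "finite S" "S \<subseteq> Basis"
  shows "f (x + (\<Sum>b\<in>S. of_int (k b) *\<^sub>R b)) = f x"
  using assms(2,3)
proof (induction S)
  case (insert b S)
  have "f (x + (\<Sum>b\<in>insert b S. of_int (k b) *\<^sub>R b)) = f ((x + (\<Sum>b\<in>S. of_int (k b) *\<^sub>R b)) + of_int (k b) *\<^sub>R b)"
    using insert by (simp add: algebra_simps)
  also have "\<dots> = f (x + (\<Sum>b\<in>S. of_int (k b) *\<^sub>R b))"
    by (rule torus_fun_add_int) (use assms insert in auto)
  finally show ?case using insert by simp
qed simp

lemma torus_fun_add_real_vec:
  fixes f :: "real ^ 'm::finite \<Rightarrow> real"
  assumes "torus_fun f"
  shows "f (x + real_vec k) = f x"
proof -
  have "real_vec k \<bullet> b = of_int \<lfloor>real_vec k \<bullet> b\<rfloor>" if "b \<in> Basis" for b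
    using that by (auto simp: Basis_vec_def real_vec_def inner_axis)
  then have "real_vec k = (\<Sum>b\<in>Basis. of_int \<lfloor>real_vec k \<bullet> b\<rfloor> *\<^sub>R b)"
    using euclidean_representation[of "real_vec k"] by (metis (no_types, lifting) sum.cong)
  then show ?thesis using torus_fun_add_int_sum[OF assms finite_Basis order_refl] by metis
qed

lemma torus_fun_bounded:
  fixes f :: "'a::euclidean_space \<Rightarrow> real"
  assumes "torus_fun f" "continuous_on UNIV f"
  obtains M where "\<And>x. \<bar>f x\<bar> \<le> M"
proof -
  have "compact (f ` cbox 0 One)"
    by (intro compact_continuous_image continuous_on_subset[OF assms(2)]) auto
  then obtain M where M: "\<And>x. x \<in> cbox 0 One \<Longrightarrow> \<bar>f x\<bar> \<le> M"
    using compact_imp_bounded bounded_iff by (metis imageI real_norm_def)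
  have "\<bar>f x\<bar> \<le> M" for x
  proof -
    let ?y = "\<Sum>b\<in>Basis. frac (x \<bullet> b) *\<^sub>R b"
    have "x = (\<Sum>b\<in>Basis. (x \<bullet> b) *\<^sub>R b)" by (simp add: euclidean_representation)
    also have "\<dots> = ?y + (\<Sum>b\<in>Basis. of_int \<lfloor>x \<bullet> b\<rfloor> *\<^sub>R b)"
      unfolding sum.distrib[symmetric] by (intro sum.cong) (auto simp: frac_def algebra_simps)
    finally have "f x = f ?y"
      using torus_fun_add_int_sum[OF assms(1) finite_Basis order_refl] by metis
    moreover have "?y \<in> cbox 0 One"
      by (auto simp: mem_box frac_lt_1 less_imp_le)
    ultimately show ?thesis using M by metis
  qed
  then show ?thesis using that by blast
qed

text \<open>The shifted cube loses the slab below t and gains the slab above 1 in direction b.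
  Translation by b maps the first onto the second, and f is periodic.\<close>

lemma integral_torus_fun_shift_Basis:
  fixes f :: "'a::euclidean_space \<Rightarrow> real"
  assumes f: "torus_fun f" "continuous_on UNIV f" and b: "b \<in> Basis" and t: "0 \<le> t" "t \<le> 1"
  shows "integral (cbox 0 One) (\<lambda>x. f (x + t *\<^sub>R b)) = integral (cbox 0 One) f"
proof -
  have int: "f integrable_on cbox u v" for u v
    by (intro integrable_continuous continuous_on_subset[OF f(2)]) auto
  \<comment> \<open>Splits off coordinate b, the only one in which the boxes below differ.\<close>
  have B: "(\<forall>i\<in>Basis. P i) \<longleftrightarrow> P b \<and> (\<forall>i\<in>Basis - {b}. P i)" for P
    using b by auto
  have bb: "b \<in> Basis" "b \<bullet> b = 1" "\<And>i. i \<in> Basis \<Longrightarrow> i \<noteq> b \<Longrightarrow> b \<bullet> i = 0"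
    using b by (auto simp: inner_Basis)
  have "integral (cbox 0 One) (\<lambda>x. f (x + t *\<^sub>R b)) = integral (cbox (t *\<^sub>R b) (One + t *\<^sub>R b)) f"
    using integral_shift_cbox[of "t *\<^sub>R b" "t *\<^sub>R b" "One + t *\<^sub>R b" f] by simp
  also have "\<dots> = integral (cbox (t *\<^sub>R b) (One + t *\<^sub>R b) \<inter> {x. x \<bullet> b \<le> 1}) f
      + integral (cbox (t *\<^sub>R b) (One + t *\<^sub>R b) \<inter> {x. x \<bullet> b \<ge> 1}) f"
    by (rule integral_split[OF int b])
  also have "cbox (t *\<^sub>R b) (One + t *\<^sub>R b) \<inter> {x. x \<bullet> b \<le> 1} = cbox 0 One \<inter> {x. x \<bullet> b \<ge> t}"
    unfolding set_eq_iff Int_iff mem_Collect_eq mem_box B using bb t by (auto simp: inner_add_left)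
  also have "cbox (t *\<^sub>R b) (One + t *\<^sub>R b) \<inter> {x. x \<bullet> b \<ge> 1} = cbox b (One + t *\<^sub>R b)"
    unfolding set_eq_iff Int_iff mem_Collect_eq mem_box B using bb t by (auto simp: inner_add_left)
  also have "integral (cbox b (One + t *\<^sub>R b)) f = integral (cbox 0 One \<inter> {x. x \<bullet> b \<le> t}) f"
  proof -
    have "integral (cbox b (One + t *\<^sub>R b)) f = integral (cbox 0 (One + t *\<^sub>R b - b)) (\<lambda>x. f (x + b))"
      using integral_shift_cbox[of b b "One + t *\<^sub>R b" f] by simp
    also have "(\<lambda>x. f (x + b)) = f" using f(1) b by (auto simp: torus_fun_def)
    also have "cbox 0 (One + t *\<^sub>R b - b) = cbox 0 One \<inter> {x. x \<bullet> b \<le> t}"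
      unfolding set_eq_iff Int_iff mem_Collect_eq mem_box B using bb t
      by (auto simp: inner_add_left inner_diff_left)
    finally show ?thesis .
  qed
  also have "integral (cbox 0 One \<inter> {x. x \<bullet> b \<ge> t}) f + integral (cbox 0 One \<inter> {x. x \<bullet> b \<le> t}) f
      = integral (cbox 0 One) f"
    using integral_split[OF int b, of 0 One t] by simp
  finally show ?thesis .
qed

lemma integral_torus_fun_shift:
  fixes f :: "'a::euclidean_space \<Rightarrow> real"
  assumes f: "torus_fun f" "continuous_on UNIV f"
  shows "integral (cbox 0 One) (\<lambda>x. f (x + a)) = integral (cbox 0 One) f"
proof -
  have "integral (cbox 0 One) (\<lambda>x. f (x + (\<Sum>b\<in>S. (a \<bullet> b) *\<^sub>R b))) = integral (cbox 0 One) f"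
    if "finite S" "S \<subseteq> Basis" for S
    using that
  proof (induction S)
    case (insert b S)
    define s where "s = (\<Sum>b\<in>S. (a \<bullet> b) *\<^sub>R b)"
    define g where "g x = f (x + s)" for x
    have g: "torus_fun g" "continuous_on UNIV g"
    proof -
      have "g (x + c) = f ((x + s) + c)" for x c by (simp add: g_def add_ac)
      then show "torus_fun g" using f(1) by (simp add: torus_fun_def g_def)
      show "continuous_on UNIV g"
        unfolding g_def by (rule continuous_on_compose2[OF f(2)]) (auto intro!: continuous_intros)
    qed
    \<comment> \<open>Periodicity absorbs the integer part of the shift, so the one-coordinate lemma
      is needed only for shifts in [0,1].\<close>
    have "f (x + (\<Sum>b\<in>insert b S. (a \<bullet> b) *\<^sub>R b)) = g (x + frac (a \<bullet> b) *\<^sub>R b)" for x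
    proof -
      have "f (x + (\<Sum>b\<in>insert b S. (a \<bullet> b) *\<^sub>R b)) = g ((x + frac (a \<bullet> b) *\<^sub>R b) + of_int \<lfloor>a \<bullet> b\<rfloor> *\<^sub>R b)"
        using insert by (simp add: g_def s_def frac_def algebra_simps)
      then show ?thesis using torus_fun_add_int[OF g(1)] insert by simp
    qed
    then have "integral (cbox 0 One) (\<lambda>x. f (x + (\<Sum>b\<in>insert b S. (a \<bullet> b) *\<^sub>R b))) = integral (cbox 0 One) g"
      using integral_torus_fun_shift_Basis[OF g, of b "frac (a \<bullet> b)"] insert
      by (simp add: frac_lt_1 less_imp_le)
    then show ?case using insert by (simp add: g_def[abs_def] s_def)
  qed simp
  from this[of Basis] show ?thesis by (simp add: euclidean_representation)
qed

lemma One_vec: "(One :: real ^ 'm::finite) = 1"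
proof (rule euclidean_eqI)
  fix b :: "real ^ 'm" assume b: "b \<in> Basis"
  then have "One \<bullet> b = 1" by simp
  also have "1 = 1 \<bullet> b" using b by (auto simp: Basis_vec_def inner_axis)
  finally show "One \<bullet> b = 1 \<bullet> b" .
qed

lemma torus_integral_shift:
  assumes "torus_fun f" "continuous_on UNIV f"
  shows "torus_integral (\<lambda>x. f (x + a)) = torus_integral f"
  using integral_torus_fun_shift[OF assms] unfolding torus_integral_def One_vec[symmetric] .

lemma torus_integral_const: "torus_integral (\<lambda>x :: real ^ 'm::finite. c) = c"
proof -
  have "measure lborel (cbox 0 (One :: real ^ 'm)) = 1"
    by (subst content_cbox) auto
  then show ?thesis unfolding torus_integral_def One_vec[symmetric] by simp
qed

text \<open>A vanishing second difference makes u affine along the orbit of x, with slope g; a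
  bounded affine sequence is constant.\<close>

lemma second_difference_zero_imp_invariant:
  fixes u :: "'a::real_vector \<Rightarrow> real"
  assumes bdd: "\<And>x. \<bar>u x\<bar> \<le> M" and eq: "\<And>x. u (x + a) + u (x - a) - 2 * u x = 0"
  shows "u (x + a) = u x"
proof (rule ccontr)
  assume ne: "u (x + a) \<noteq> u x"
  define g where "g = u (x + a) - u x"
  have step: "u (x + (real n + 1) *\<^sub>R a) - u (x + real n *\<^sub>R a) = g" for n
  proof (induction n)
    case (Suc n)
    have "u ((x + (real n + 1) *\<^sub>R a) + a) + u ((x + (real n + 1) *\<^sub>R a) - a) - 2 * u (x + (real n + 1) *\<^sub>R a) = 0"
      by (rule eq)
    then show ?case using Suc by (simp add: algebra_simps scaleR_2)
  qed (simp add: g_def)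
  have lin: "u (x + real n *\<^sub>R a) = u x + real n * g" for n
  proof (induction n)
    case (Suc n)
    then show ?case using step[of n] by (simp add: algebra_simps)
  qed simp
  obtain n where "2 * M < real n * \<bar>g\<bar>"
    using reals_Archimedean3[of "\<bar>g\<bar>"] ne by (auto simp: g_def)
  moreover have "\<bar>real n * g\<bar> \<le> 2 * M"
    using lin[of n] bdd[of x] bdd[of "x + real n *\<^sub>R a"] by linarith
  ultimately show False by (simp add: abs_mult)
qed

text \<open>Kronecker's theorem for the coordinates of \<Omega> together with the number 1:
  nonresonance says exactly that these are linearly independent over the integers.\<close>

lemma nonresonant_orbit_dense:
  fixes \<Omega> :: "real ^ 'm::finite"
  assumes nonres: "\<And>k :: int ^ 'm. k \<noteq> 0 \<Longrightarrow> \<Omega> \<bullet> real_vec k \<notin> \<int>" and "\<delta> > 0"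
  obtains k :: int and m :: "int ^ 'm" where "norm (of_int k *\<^sub>R \<Omega> + real_vec m - z) < \<delta>"
proof -
  define n where "n = CARD('m)"
  have n: "n > 0" by (simp add: n_def)
  obtain e where e: "bij_betw e {..<n} (UNIV :: 'm set)"
    using ex_bij_betw_nat_finite[of "UNIV :: 'm set"] by (auto simp: n_def atLeast0LessThan)
  \<comment> \<open>The additional entry 1 stands for the integer side: a relation with coefficients
    a means \<Omega> . k = - a(n), with k formed from the other coefficients.\<close>
  define \<theta> where "\<theta> i = (if i < n then \<Omega> $ e i else 1)" for i
  have rel: "a i = 0" if a: "(\<Sum>i\<le>n. of_int (a i) * \<theta> i) = 0" "i \<le> n" for a :: "nat \<Rightarrow> int" and i
  proof -
    define k :: "int ^ 'm" where "k = (\<chi> j. a (the_inv_into {..<n} e j))"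
    have k: "k $ e i = a i" if "i < n" for i
      using that e by (simp add: k_def the_inv_into_f_f bij_betw_def)
    have "\<Omega> \<bullet> real_vec k = (\<Sum>j\<in>UNIV. \<Omega> $ j * of_int (k $ j))"
      by (simp add: inner_vec_def real_vec_def)
    also have "\<dots> = (\<Sum>i<n. \<Omega> $ e i * of_int (k $ e i))"
      using sum.reindex_bij_betw[OF e, of "\<lambda>j. \<Omega> $ j * of_int (k $ j)"] by simp
    also have "\<dots> = (\<Sum>i<n. of_int (a i) * \<theta> i)"
      by (intro sum.cong) (auto simp: k \<theta>_def)
    also have "\<dots> = - of_int (a n)"
      using a(1) by (simp add: lessThan_Suc_atMost[symmetric] \<theta>_def)
    finally have *: "\<Omega> \<bullet> real_vec k = of_int (- a n)" by simp
    then have "\<Omega> \<bullet> real_vec k \<in> \<int>" by (metis Ints_of_int)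
    then have "k = 0" using nonres by blast
    then have "a n = 0" "\<And>i. i < n \<Longrightarrow> a i = 0"
      using * k by (auto simp: real_vec_def inner_vec_def)
    then show ?thesis using a(2) by (cases "i = n") auto
  qed
  \<comment> \<open>Independence is a property of the set of values, so the entries must also be
    distinct; equality of two of them would be an integer relation with coefficients 1 and
    -1.\<close>
  have inj: "inj_on \<theta> {..n}"
  proof (rule inj_onI, rule ccontr)
    fix i j assume ij: "i \<in> {..n}" "j \<in> {..n}" "\<theta> i = \<theta> j" "i \<noteq> j"
    let ?a = "\<lambda>l. (if l = i then 1 else if l = j then - 1 else 0) :: int"
    have "(\<Sum>l\<le>n. of_int (?a l) * \<theta> l) = (\<Sum>l\<in>{i, j}. of_int (?a l) * \<theta> l)"
      by (rule sum.mono_neutral_right) (use ij in auto)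
    also have "\<dots> = 0" using ij by simp
    finally show False using rel[of ?a i] ij by simp
  qed
  \<comment> \<open>The reals as a module over the integers, the form in which Kronecker's theorem
    expresses independence.\<close>
  interpret Modules.module "\<lambda>r x. real_of_int r * x"
    by (simp add: Modules.module.intro distrib_left mult.commute)
  have ind: "independent (\<theta> ` {..n})"
    unfolding independent_explicit_module
  proof (intro allI impI)
    fix t u v assume t: "finite t" "t \<subseteq> \<theta> ` {..n}" "(\<Sum>v\<in>t. of_int (u v) * v) = 0" "v \<in> t"
    define a where "a i = (if \<theta> i \<in> t then u (\<theta> i) else 0)" for i
    have "(\<Sum>i\<le>n. of_int (a i) * \<theta> i) = (\<Sum>v\<in>\<theta> ` {..n}. of_int (if v \<in> t then u v else 0) * v)"
      unfolding sum.reindex[OF inj] by (simp add: a_def)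
    also have "\<dots> = (\<Sum>v\<in>t. of_int (if v \<in> t then u v else 0) * v)"
      by (rule sum.mono_neutral_right) (use t in auto)
    also have "\<dots> = 0" using t(3) by simp
    finally have "a i = 0" if "i \<le> n" for i using rel that by blast
    moreover obtain i where "i \<le> n" "v = \<theta> i" using t(2,4) by auto
    ultimately show "u v = 0" using t(4) unfolding a_def by metis
  qed
  \<comment> \<open>An error below \<delta>/n in each of the n coordinates keeps the l1 norm, hence
    the Euclidean norm, below \<delta>.\<close>
  have "\<delta> / n > 0" using assms(2) n by simp
  then obtain k m where km: "\<And>i. i < n \<Longrightarrow> \<bar>of_int k * \<theta> i - of_int (m i) - z $ e i\<bar> < \<delta> / n"
    using Kronecker_thm_2[OF ind inj, of "\<delta> / n" "\<lambda>i. z $ e i"] by (auto simp: \<theta>_def)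
  define m' :: "int ^ 'm" where "m' = (\<chi> j. - m (the_inv_into {..<n} e j))"
  have m': "m' $ e i = - m i" if "i < n" for i
    using that e by (simp add: m'_def the_inv_into_f_f bij_betw_def)
  define y where "y = of_int k *\<^sub>R \<Omega> + real_vec m' - z"
  have "norm y \<le> (\<Sum>j\<in>UNIV. \<bar>y $ j\<bar>)" by (rule norm_le_l1_cart)
  also have "\<dots> = (\<Sum>i<n. \<bar>y $ e i\<bar>)"
    using sum.reindex_bij_betw[OF e, of "\<lambda>j. \<bar>y $ j\<bar>"] by simp
  also have "\<dots> < (\<Sum>i<n. \<delta> / n)"
    by (rule sum_strict_mono) (use n km m' in \<open>auto simp: y_def real_vec_def \<theta>_def\<close>)
  also have "\<dots> = \<delta>" using n by simp
  finally show ?thesis using that unfolding y_def by blast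
qed

text \<open>By invariance and periodicity u equals u(x) along the orbit of x modulo integer vectors;
  that orbit comes arbitrarily close to y, and u is continuous.\<close>

lemma invariant_torus_fun_const:
  fixes u :: "real ^ 'm::finite \<Rightarrow> real"
  assumes u: "torus_fun u" "continuous_on UNIV u" and inv: "\<And>x. u (x + \<Omega>) = u x"
    and nonres: "\<And>k :: int ^ 'm. k \<noteq> 0 \<Longrightarrow> \<Omega> \<bullet> real_vec k \<notin> \<int>"
  shows "u x = u y"
proof (rule ccontr)
  assume "u x \<noteq> u y"
  then have "\<bar>u x - u y\<bar> > 0" by simp
  then obtain \<delta> where \<delta>: "\<delta> > 0" "\<And>w. norm (w - y) < \<delta> \<Longrightarrow> \<bar>u w - u y\<bar> < \<bar>u x - u y\<bar>"
    using u(2) unfolding continuous_on_iff dist_norm by (metis UNIV_I real_norm_def)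
  obtain k m where km: "norm (of_int k *\<^sub>R \<Omega> + real_vec m - (y - x)) < \<delta>"
    using nonresonant_orbit_dense[OF nonres \<delta>(1)] by metis
  have nat: "u (x + of_nat n *\<^sub>R \<Omega>) = u x" for x n
  proof (induction n)
    case (Suc n)
    then show ?case using inv[of "x + of_nat n *\<^sub>R \<Omega>"] by (simp add: algebra_simps)
  qed simp
  have "u (x + of_int k *\<^sub>R \<Omega>) = u x"
  proof (cases "k \<ge> 0")
    case True
    then show ?thesis using nat[of x "nat k"] by simp
  next
    case False
    then show ?thesis using nat[of "x + of_int k *\<^sub>R \<Omega>" "nat (- k)"] by simp
  qed
  then have "u (x + of_int k *\<^sub>R \<Omega> + real_vec m) = u x"
    using torus_fun_add_real_vec[OF u(1)] by simp
  moreover have "norm (x + of_int k *\<^sub>R \<Omega> + real_vec m - y) < \<delta>"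
    using km by (simp add: algebra_simps)
  ultimately show False using \<delta>(2) by fastforce
qed

section \<open>Low orders of the formal solution\<close>

lemma point_add: "point (\<psi> + \<psi>') (\<eta> + \<eta>') = point \<psi> \<eta> + point \<psi>' \<eta>'"
  by (simp add: point_def vec_eq_iff split: option.split)

lemma point_scaleR: "point (c *\<^sub>R \<psi>) (c * \<eta>) = c *\<^sub>R point \<psi> \<eta>"
  by (simp add: point_def vec_eq_iff split: option.split)

lemma point_sum: "point (\<Sum>i\<in>A. f i) (\<Sum>i\<in>A. g i) = (\<Sum>i\<in>A. point (f i) (g i))"
proof (cases "finite A")
  case True
  then show ?thesis
    by induction (simp_all add: point_add, simp add: point_def vec_eq_iff split: option.split)
qed (simp add: point_def vec_eq_iff split: option.split)

lemma point_conv_axis: "point \<psi> \<eta> = point \<psi> 0 + \<eta> *\<^sub>R axis None 1"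
  by (simp add: point_def vec_eq_iff axis_def split: option.split)

lemma point_add_axis: "point (\<psi> + axis j 1) \<eta> = point \<psi> \<eta> + axis (Some j) 1"
  by (auto simp add: point_def vec_eq_iff axis_def split: option.split)

lemma continuous_on_point [continuous_intros]:
  assumes "continuous_on S f" "continuous_on S g"
  shows "continuous_on S (\<lambda>x. point (f x) (g x))"
  unfolding point_def
proof (rule continuous_on_vec_lambda)
  show "continuous_on S (\<lambda>x. case i of None \<Rightarrow> g x | Some j \<Rightarrow> f x $ j)" for i
    using assms by (cases i) (auto intro!: continuous_intros)
qed

lemma torus_fun_slice:
  assumes "torus_fun f"
  shows "torus_fun (\<lambda>\<psi>. f (point \<psi> \<eta>))"
  unfolding torus_fun_def
proof (intro allI ballI)
  fix x b :: "real ^ 'a" assume "b \<in> Basis"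
  then obtain j where "b = axis j 1" by (auto simp: Basis_vec_def)
  moreover have "axis (Some j) (1::real) \<in> Basis" by (simp add: axis_in_Basis_iff)
  ultimately show "f (point (x + b) \<eta>) = f (point x \<eta>)"
    using assms by (simp add: point_add_axis torus_fun_def)
qed

lemma has_field_derivative_slice:
  assumes "g differentiable (at (point \<psi> \<eta>))"
  shows "((\<lambda>\<eta>. g (point \<psi> \<eta>)) has_field_derivative dir_deriv (axis None 1) g (point \<psi> \<eta>)) (at \<eta>)"
proof -
  let ?D = "frechet_derivative g (at (point \<psi> \<eta>))"
  have D: "(g has_derivative ?D) (at (point \<psi> \<eta>))"
    using assms frechet_derivative_works by blast
  have "((\<lambda>\<eta>. point \<psi> 0 + \<eta> *\<^sub>R axis None 1) has_derivative (\<lambda>h. h *\<^sub>R axis None 1)) (at \<eta>)"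
    by (auto intro!: derivative_eq_intros)
  then have "(point \<psi> has_derivative (\<lambda>h. h *\<^sub>R axis None 1)) (at \<eta>)"
    by (simp flip: point_conv_axis)
  then have "(g \<circ> point \<psi> has_derivative ?D \<circ> (\<lambda>h. h *\<^sub>R axis None 1)) (at \<eta>)"
    using D by (rule diff_chain_at)
  then show ?thesis
    unfolding has_field_derivative_def o_def
    by (rule has_derivative_eq_rhs)
      (simp add: fun_eq_iff dir_deriv_def linear_scale[OF has_derivative_linear[OF D]])
qed

lemma dir_deriv_real:
  assumes "(f has_field_derivative D) (at x)"
  shows "dir_deriv 1 f x = D"
  using assms frechet_derivative_at[of f "(*) D" x]
  unfolding has_field_derivative_def dir_deriv_def by (metis mult.right_neutral)

lemma smooth_slice:
  fixes f :: "real ^ 'm::finite option \<Rightarrow> real"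
  assumes "smooth f"
  shows "smooth (\<lambda>\<eta>. f (point \<psi> \<eta>))"
proof -
  \<comment> \<open>A word over the basis of the reals consists of letters 1 only; its counterpart
    repeats the direction of the last coordinate equally often.\<close>
  let ?w = "map (\<lambda>_. axis None 1 :: real ^ 'm option)"
  have B: "set (?w w) \<subseteq> Basis" for w :: "real list"
    by (auto simp: axis_in_Basis_iff)
  have D: "((\<lambda>\<eta>. partials (?w w) f (point \<psi> \<eta>)) has_field_derivative
      partials (?w (1 # w)) f (point \<psi> \<eta>)) (at \<eta>)" for w :: "real list" and \<eta>
    unfolding list.map partials_Cons
    by (rule has_field_derivative_slice) (use assms B in \<open>simp add: smooth_def\<close>)
  have eq: "partials w (\<lambda>\<eta>. f (point \<psi> \<eta>)) = (\<lambda>\<eta>. partials (?w w) f (point \<psi> \<eta>))"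
    if "set w \<subseteq> Basis" for w
    using that
  proof (induction w)
    case (Cons b w)
    then have "b = 1" by simp
    then show ?case using Cons dir_deriv_real[OF D] by (auto simp: partials_Cons)
  qed simp
  show ?thesis
    unfolding smooth_def using D eq by (metis field_differentiable_def field_differentiable_imp_differentiable)
qed

section \<open>The equations of order zero and one\<close>

lemma formal_solution_nth:
  assumes "normalized_formal_solution W \<beta> \<Omega> v lam"
  shows "v n (point (\<psi> + \<Omega>) \<eta>) + v n (point (\<psi> - \<Omega>) \<eta>) - 2 * v n (point \<psi> \<eta>)
    + (if n = 0 then 0 else fps_nth (taylor_subst W
        (fps_const (point \<psi> \<eta>) + Abs_fps (\<lambda>n. v n (point \<psi> \<eta>) *\<^sub>R \<beta>))) (n - 1))
    + lam n \<eta> = 0"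
proof -
  have "Abs_fps (\<lambda>n. v n (point (\<psi> + \<Omega>) \<eta>)) + Abs_fps (\<lambda>n. v n (point (\<psi> - \<Omega>) \<eta>))
        - 2 * Abs_fps (\<lambda>n. v n (point \<psi> \<eta>))
        + fps_X * taylor_subst W
            (fps_const (point \<psi> \<eta>) + Abs_fps (\<lambda>n. v n (point \<psi> \<eta>) *\<^sub>R \<beta>))
        + Abs_fps (\<lambda>n. lam n \<eta>) = 0"
    using assms unfolding normalized_formal_solution_def by blast
  from arg_cong[where f = "\<lambda>p. fps_nth p n", OF this] show ?thesis
    by (simp add: numeral_fps_const)
qed

lemma formal_solution_analytic:
  assumes "normalized_formal_solution W \<beta> \<Omega> v lam"
  shows "torus_fun (v n)" "smooth (v n)" "smooth (lam n)"
  using assms unfolding normalized_formal_solution_def torus_analytic_def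
  by (auto intro: real_analytic_imp_smooth)

lemma smooth_continuous_on_compose:
  assumes "smooth f" "continuous_on S g"
  shows "continuous_on S (\<lambda>x. f (g x))"
  using continuous_on_compose2[OF smooth_continuous_on[OF assms(1), of "[]" UNIV] assms(2)] by simp

lemma formal_solution_slice:
  assumes "normalized_formal_solution W \<beta> \<Omega> v lam"
  shows "torus_fun (\<lambda>\<psi>. v n (point \<psi> \<eta>))" "continuous_on UNIV (\<lambda>\<psi>. v n (point \<psi> \<eta>))"
proof -
  show "torus_fun (\<lambda>\<psi>. v n (point \<psi> \<eta>))"
    by (rule torus_fun_slice[OF formal_solution_analytic(1)[OF assms]])
  show "continuous_on UNIV (\<lambda>\<psi>. v n (point \<psi> \<eta>))"
    by (intro smooth_continuous_on_compose[OF formal_solution_analytic(2)[OF assms]] continuous_intros)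
qed

lemma torus_integral_second_difference:
  assumes u: "torus_fun u" "continuous_on UNIV u"
  shows "torus_integral (\<lambda>\<psi>. u (\<psi> + \<Omega>) + u (\<psi> - \<Omega>) - 2 * u \<psi>) = 0"
proof -
  have int: "(\<lambda>\<psi>. u (\<psi> + a)) integrable_on cbox 0 1" for a
    by (intro integrable_continuous continuous_on_compose2[OF u(2)] continuous_intros) auto
  have I: "((\<lambda>\<psi>. u (\<psi> + a)) has_integral torus_integral u) (cbox 0 1)" for a
    using integrable_integral[OF int] torus_integral_shift[OF u] unfolding torus_integral_def by metis
  have "((\<lambda>\<psi>. u (\<psi> + \<Omega>) + u (\<psi> + - \<Omega>) - 2 * u (\<psi> + 0)) has_integral
      torus_integral u + torus_integral u - 2 * torus_integral u) (cbox 0 1)"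
    by (intro has_integral_diff has_integral_add has_integral_mult_right I)
  then show ?thesis unfolding torus_integral_def by (simp add: integral_unique)
qed

text \<open>At order 0 the equation says that the second difference of \<open>v\<^sup>0\<close> is constant; that constant
  integrates to 0, so the boundedness of \<open>v\<^sup>0\<close> forces invariance under \<open>\<Omega>\<close>.\<close>

lemma formal_solution_order_0:
  assumes sol: "normalized_formal_solution W \<beta> \<Omega> v lam"
    and nonres: "\<And>k :: int ^ 'm::finite. k \<noteq> 0 \<Longrightarrow> \<Omega> \<bullet> real_vec k \<notin> \<int>"
  shows "lam 0 = (\<lambda>_. 0)" "v 0 (point \<psi> \<eta>) = 0"
proof -
  have u: "torus_fun (\<lambda>\<psi>. v 0 (point \<psi> \<eta>))" "continuous_on UNIV (\<lambda>\<psi>. v 0 (point \<psi> \<eta>))" for \<eta>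
    by (rule formal_solution_slice[OF sol])+
  have eq: "v 0 (point (\<psi> + \<Omega>) \<eta>) + v 0 (point (\<psi> - \<Omega>) \<eta>) - 2 * v 0 (point \<psi> \<eta>) = - lam 0 \<eta>" for \<psi> \<eta>
    using formal_solution_nth[OF sol, of 0 \<psi> \<eta>] by simp
  have lam0: "lam 0 \<eta> = 0" for \<eta>
    using torus_integral_second_difference[OF u[of \<eta>], of \<Omega>] by (simp add: eq torus_integral_const)
  then show "lam 0 = (\<lambda>_. 0)" by auto
  obtain M where M: "\<And>\<psi>. \<bar>v 0 (point \<psi> \<eta>)\<bar> \<le> M" using torus_fun_bounded[OF u[of \<eta>]] by metis
  have "v 0 (point (\<psi> + \<Omega>) \<eta>) = v 0 (point \<psi> \<eta>)" for \<psi>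
    by (rule second_difference_zero_imp_invariant[OF M]) (simp add: eq lam0)
  then have "v 0 (point \<psi>' \<eta>) = v 0 (point \<psi> \<eta>)" for \<psi>'
    by (rule invariant_torus_fun_const[OF u[of \<eta>] _ nonres])
  then have const: "(\<lambda>\<psi>'. v 0 (point \<psi>' \<eta>)) = (\<lambda>_. v 0 (point \<psi> \<eta>))" by blast
  have "torus_integral (\<lambda>\<psi>. v 0 (point \<psi> \<eta>)) = 0"
    using sol unfolding normalized_formal_solution_def by blast
  then show "v 0 (point \<psi> \<eta>) = 0" unfolding const torus_integral_const .
qed

lemma formal_solution_lam_1:
  assumes sol: "normalized_formal_solution W \<beta> \<Omega> v lam"
    and nonres: "\<And>k :: int ^ 'm::finite. k \<noteq> 0 \<Longrightarrow> \<Omega> \<bullet> real_vec k \<notin> \<int>"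
    and W: "smooth W"
  shows "lam 1 \<eta> = - torus_integral (\<lambda>\<psi>. W (point \<psi> \<eta>))"
proof -
  have u: "torus_fun (\<lambda>\<psi>. v 1 (point \<psi> \<eta>))" "continuous_on UNIV (\<lambda>\<psi>. v 1 (point \<psi> \<eta>))"
    by (rule formal_solution_slice[OF sol])+
  have "v 1 (point (\<psi> + \<Omega>) \<eta>) + v 1 (point (\<psi> - \<Omega>) \<eta>) - 2 * v 1 (point \<psi> \<eta>)
      = - W (point \<psi> \<eta>) - lam 1 \<eta>" for \<psi>
    \<comment> \<open>As v of order 0 vanishes, the series inside W has constant term
      (\<psi>,\<eta>); so W contributes exactly W(\<psi>,\<eta>) at order one.\<close>
    using formal_solution_nth[OF sol, of 1 \<psi> \<eta>]
    by (simp add: formal_solution_order_0(2)[OF sol nonres])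
  then have "torus_integral (\<lambda>\<psi>. - W (point \<psi> \<eta>) - lam 1 \<eta>) = 0"
    using torus_integral_second_difference[OF u, of \<Omega>] by simp
  moreover have "torus_integral (\<lambda>\<psi>. - W (point \<psi> \<eta>) - lam 1 \<eta>)
      = - torus_integral (\<lambda>\<psi>. W (point \<psi> \<eta>)) - torus_integral (\<lambda>\<psi> :: real ^ 'm. lam 1 \<eta>)"
  proof -
    have "(\<lambda>\<psi>. W (point \<psi> \<eta>)) integrable_on cbox 0 1"
      by (intro integrable_continuous smooth_continuous_on_compose[OF W] continuous_intros)
    then show ?thesis
      unfolding torus_integral_def by (subst integral_diff) (auto intro: integrable_neg)
  qed
  ultimately show ?thesis by (simp add: torus_integral_const)
qed

text \<open>Differentiation under the integral, by which the nondegeneracy hypothesis becomes a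
  nonzero derivative of \<open>lam 1\<close>.\<close>

lemma torus_integral_has_field_derivative:
  fixes W :: "real ^ 'm::finite option \<Rightarrow> real"
  assumes W: "smooth W"
  shows "((\<lambda>\<eta>. torus_integral (\<lambda>\<psi>. W (point \<psi> \<eta>))) has_field_derivative
    torus_integral (\<lambda>\<psi>. dir_deriv (axis None 1) W (point \<psi> \<eta>))) (at \<eta>)"
  unfolding torus_integral_def
proof (rule leibniz_rule_field_derivative)
  show "((\<lambda>\<eta>. W (point \<psi> \<eta>)) has_field_derivative dir_deriv (axis None 1) W (point \<psi> \<eta>)) (at \<eta>)" for \<psi> \<eta>
    using W unfolding smooth_def by (intro has_field_derivative_slice) (metis empty_subsetI list.set(1) partials_Nil)
  show "(\<lambda>\<psi>. W (point \<psi> \<eta>)) integrable_on cbox 0 1" for \<eta>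
    by (intro integrable_continuous smooth_continuous_on_compose[OF W] continuous_intros)
  have "continuous_on UNIV (dir_deriv (axis None 1) W)"
    using smooth_continuous_on[OF W, of "[axis None 1]" UNIV] by (simp add: partials_Cons axis_in_Basis_iff)
  then show "continuous_on (UNIV \<times> cbox 0 1) (\<lambda>(\<eta>, \<psi>). dir_deriv (axis None 1) W (point \<psi> \<eta>))"
    unfolding case_prod_unfold by (rule continuous_on_compose2) (auto intro!: continuous_intros)
qed auto

section \<open>A formal implicit function theorem\<close>

lemma prod_list_fps_nth_cong:
  fixes g h :: "'b \<Rightarrow> real fps"
  assumes "\<And>b k. k \<le> m \<Longrightarrow> fps_nth (g b) k = fps_nth (h b) k"
  shows "fps_nth (prod_list (map g w)) m = fps_nth (prod_list (map h w)) m"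
  using assms
proof (induction w arbitrary: m)
  case (Cons b w)
  have "fps_nth (g b) i = fps_nth (h b) i"
    "fps_nth (prod_list (map g w)) (m - i) = fps_nth (prod_list (map h w)) (m - i)" if "i \<le> m" for i
    using that by (auto intro!: Cons)
  then show ?case by (simp add: fps_mult_nth)
qed simp

text \<open>With at least two factors of positive order, a coefficient of index m in one factor
  would leave degree 0 for the others, where they vanish. So only coefficients below m
  matter.\<close>

lemma prod_list_fps_nth_cong_strict:
  fixes g h :: "'b \<Rightarrow> real fps"
  assumes g0: "\<And>b. fps_nth (g b) 0 = 0" and h0: "\<And>b. fps_nth (h b) 0 = 0"
    and eq: "\<And>b k. k < m \<Longrightarrow> fps_nth (g b) k = fps_nth (h b) k" and "length w \<ge> 2"
  shows "fps_nth (prod_list (map g w)) m = fps_nth (prod_list (map h w)) m"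
proof -
  obtain b w' where w: "w = b # w'"
    using assms(4) by (cases w) auto
  then have w': "length w' > 0"
    using assms(4) by (cases w') auto
  have "fps_nth (g b) i * fps_nth (prod_list (map g w')) (m - i)
      = fps_nth (h b) i * fps_nth (prod_list (map h w')) (m - i)" if i: "i \<le> m" for i
  proof -
    consider "i = 0" | "i = m" | "0 < i" "i < m" using i by linarith
    then show ?thesis
    proof cases
      case 1
      then show ?thesis by (simp add: g0 h0)
    next
      case 2
      have "fps_nth (prod_list (map g w')) 0 = 0" "fps_nth (prod_list (map h w')) 0 = 0"
        by (rule prod_list_fps_nth_eq_0; use w' g0 h0 in auto)+
      then show ?thesis using 2 by simp
    next
      case 3
      have "fps_nth (prod_list (map g w')) (m - i) = fps_nth (prod_list (map h w')) (m - i)"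
        by (rule prod_list_fps_nth_cong) (use 3 eq in auto)
      then show ?thesis using 3 eq by simp
    qed
  qed
  then show ?thesis by (simp add: w fps_mult_nth)
qed

lemma taylor_subst_nth_cong:
  assumes "\<And>k. k \<le> m \<Longrightarrow> fps_nth X k = fps_nth Y k"
  shows "fps_nth (taylor_subst f X) m = fps_nth (taylor_subst f Y) m"
proof -
  have "fps_nth (prod_list (map (increment X) w)) m = fps_nth (prod_list (map (increment Y) w)) m" for w
    by (rule prod_list_fps_nth_cong) (use assms in \<open>auto simp: increment_nth\<close>)
  then show ?thesis using assms[of 0] by (simp add: taylor_subst_nth)
qed

text \<open>Only the linear Taylor term sees the m-th coefficient: the term of degree 0 depends on
  the common constant term alone, and the terms of degree at least 2 agree by
  \<open>prod_list_fps_nth_cong_strict\<close>.\<close>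

lemma taylor_subst_nth_diff:
  fixes f :: "real \<Rightarrow> real"
  assumes m: "0 < m" and eq: "\<And>k. k < m \<Longrightarrow> fps_nth X k = fps_nth Y k"
  shows "fps_nth (taylor_subst f X) m - fps_nth (taylor_subst f Y) m
    = dir_deriv 1 f (fps_nth X 0) * (fps_nth X m - fps_nth Y m)"
proof -
  define T where "T Z j = (\<Sum>w\<in>words j. partials w f (fps_nth X 0) / fact j
    * fps_nth (prod_list (map (increment Z) w)) m)" for Z and j :: nat
  have "fps_nth Y 0 = fps_nth X 0" using eq[of 0] m by simp
  then have "fps_nth (taylor_subst f X) m - fps_nth (taylor_subst f Y) m = (\<Sum>j\<le>m. T X j - T Y j)"
    by (simp add: taylor_subst_nth T_def sum_subtractf)
  also have "\<dots> = (\<Sum>j\<in>{1}. T X j - T Y j)"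
  proof (rule sum.mono_neutral_right)
    show "\<forall>j\<in>{..m} - {1}. T X j - T Y j = 0"
    proof
      fix j assume j: "j \<in> {..m} - {1}"
      show "T X j - T Y j = 0"
      proof (cases "j = 0")
        case True
        then show ?thesis by (simp add: T_def)
      next
        case False
        then have "j \<ge> 2" using j by auto
        then have "fps_nth (prod_list (map (increment X) w)) m = fps_nth (prod_list (map (increment Y) w)) m"
          if "w \<in> words j" for w
          using that eq by (intro prod_list_fps_nth_cong_strict) (auto simp: increment_nth words_def)
        then show ?thesis by (simp add: T_def)
      qed
    qed
  qed (use m in auto)
  also have "\<dots> = dir_deriv 1 f (fps_nth X 0) * (fps_nth X m - fps_nth Y m)"
    using m by (simp add: T_def sum_words_Suc partials_Cons increment_nth algebra_simps)
  finally show ?thesis .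
qed

lemma taylor_subst_zero [simp]: "taylor_subst (\<lambda>_. 0) X = 0"
proof -
  have "partials w (\<lambda>_. 0) = (\<lambda>_. 0)" for w :: "'a list"
    by (induction w) (auto simp: partials_Cons dir_deriv_def)
  then show ?thesis by (simp add: fps_eq_iff taylor_subst_nth)
qed

lemma series_subst_nth:
  "fps_nth (series_subst F X) n = (\<Sum>i\<le>n. fps_nth (taylor_subst (F i) X) (n - i))"
  by (simp add: series_subst_def)

text \<open>As \<open>F 0\<close> vanishes, every remaining term carries a factor \<epsilon>, so
  only coefficients of X below n are reached.\<close>

lemma series_subst_nth_cong:
  assumes "F 0 = (\<lambda>_. 0)" "\<And>k. k < n \<Longrightarrow> fps_nth X k = fps_nth Y k"
  shows "fps_nth (series_subst F X) n = fps_nth (series_subst F Y) n"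
  unfolding series_subst_nth
proof (rule sum.cong[OF refl])
  fix i assume "i \<in> {..n}"
  then show "fps_nth (taylor_subst (F i) X) (n - i) = fps_nth (taylor_subst (F i) Y) (n - i)"
    using assms by (cases "i = 0") (auto intro!: taylor_subst_nth_cong)
qed

text \<open>At order m+1 the terms with i \<ge> 2 reach at most coefficient m-1 of the argument,
  while \<open>F 1\<close> reaches coefficient m, and does so linearly.\<close>

lemma series_subst_nth_diff:
  fixes F :: "nat \<Rightarrow> real \<Rightarrow> real"
  assumes F0: "F 0 = (\<lambda>_. 0)" and m: "0 < m" and eq: "\<And>k. k < m \<Longrightarrow> fps_nth X k = fps_nth Y k"
  shows "fps_nth (series_subst F X) (Suc m) - fps_nth (series_subst F Y) (Suc m)
    = dir_deriv 1 (F 1) (fps_nth X 0) * (fps_nth X m - fps_nth Y m)"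
proof -
  let ?d = "\<lambda>i. fps_nth (taylor_subst (F i) X) (Suc m - i) - fps_nth (taylor_subst (F i) Y) (Suc m - i)"
  have "fps_nth (series_subst F X) (Suc m) - fps_nth (series_subst F Y) (Suc m) = (\<Sum>i\<le>Suc m. ?d i)"
    unfolding series_subst_nth sum_subtractf ..
  also have "\<dots> = (\<Sum>i\<in>{1}. ?d i)"
  proof (rule sum.mono_neutral_right)
    show "\<forall>i\<in>{..Suc m} - {1}. ?d i = 0"
    proof
      fix i assume i: "i \<in> {..Suc m} - {1}"
      show "?d i = 0"
      proof (cases "i = 0")
        case False
        then have "fps_nth (taylor_subst (F i) X) (Suc m - i) = fps_nth (taylor_subst (F i) Y) (Suc m - i)"
          using i by (intro taylor_subst_nth_cong eq) auto
        then show ?thesis by simp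
      qed (simp add: F0)
    qed
  qed auto
  also have "\<dots> = dir_deriv 1 (F 1) (fps_nth X 0) * (fps_nth X m - fps_nth Y m)"
    using taylor_subst_nth_diff[OF m eq, of "F 1"] by simp
  finally show ?thesis .
qed

lemma formal_implicit_function:
  fixes F :: "nat \<Rightarrow> real \<Rightarrow> real"
  assumes F0: "F 0 = (\<lambda>_. 0)" and F1: "F 1 x0 = 0" and D: "dir_deriv 1 (F 1) x0 \<noteq> 0"
  obtains H where "fps_nth H 0 = x0" "series_subst F H = 0"
proof -
  \<comment> \<open>The Newton correction: subtracting c at degree n+1 of P cancels the coefficient
    n+2 of the substituted series.\<close>
  define c where "c P n = fps_nth (series_subst F P) (n + 2) / dir_deriv 1 (F 1) x0" for P n
  define P where "P = rec_nat (fps_const x0) (\<lambda>n P. P - fps_const (c P n) * fps_X ^ Suc n)"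
  have P0: "P 0 = fps_const x0" and PS: "P (Suc n) = P n - fps_const (c (P n) n) * fps_X ^ Suc n" for n
    by (simp_all add: P_def)
  have PS_nth: "fps_nth (P (Suc n)) k = (if k = Suc n then fps_nth (P n) k - c (P n) n else fps_nth (P n) k)" for n k
    unfolding PS fps_sub_nth fps_mult_left_const_nth fps_X_power_nth by simp
  \<comment> \<open>The stages stabilise: the k-th coefficient is not altered after stage k, so the
    diagonal is their limit.\<close>
  define H where "H = Abs_fps (\<lambda>k. fps_nth (P k) k)"
  have P_H: "fps_nth (P n) k = fps_nth H k" if "k \<le> n" for n k
    using that by (induction n) (auto simp: H_def PS_nth le_Suc_eq)
  have H0: "fps_nth H 0 = x0" by (simp add: H_def P0)
  have "fps_nth (series_subst F H) n = 0" for n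
  proof -
    consider "n = 0" | "n = 1" | m where "n = m + 2"
      by (metis One_nat_def Suc_1 add_2_eq_Suc' not0_implies_Suc)
    then show ?thesis
    proof cases
      case 1
      then show ?thesis by (simp add: series_subst_nth F0)
    next
      case 2
      then show ?thesis by (simp add: series_subst_nth F0 F1[unfolded One_nat_def] H0)
    next
      case (3 m)
      have "fps_nth (series_subst F H) (m + 2) = fps_nth (series_subst F (P (Suc m))) (m + 2)"
        by (rule series_subst_nth_cong[where F = F, OF F0]) (simp add: P_H)
      also have "\<dots> = fps_nth (series_subst F (P m)) (m + 2)
          + dir_deriv 1 (F 1) x0 * (fps_nth (P (Suc m)) (Suc m) - fps_nth (P m) (Suc m))"
        using series_subst_nth_diff[of F "Suc m" "P (Suc m)" "P m", OF F0] PS_nth P_H[of 0 "Suc m"] H0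
        by simp
      also have "\<dots> = 0" using D by (simp add: PS_nth c_def)
      finally show ?thesis using 3 by simp
    qed
  qed
  then have "series_subst F H = 0" by (simp add: fps_eq_iff)
  with H0 show ?thesis using that by blast
qed

section \<open>Substitution into the formal equation\<close>

text \<open>Agreement modulo O(t^(N+1)), required on all of [-1,1] rather than near 0, so that
  estimates combine without shrinking neighbourhoods.\<close>

definition eq_upto :: "nat \<Rightarrow> (real \<Rightarrow> real) \<Rightarrow> (real \<Rightarrow> real) \<Rightarrow> bool" where
  "eq_upto N f g \<longleftrightarrow> (\<exists>C. \<forall>t. \<bar>t\<bar> \<le> 1 \<longrightarrow> \<bar>f t - g t\<bar> \<le> C * \<bar>t\<bar> ^ (N + 1))"

lemma eq_uptoI:
  assumes "\<And>t. \<bar>t\<bar> \<le> 1 \<Longrightarrow> \<bar>f t - g t\<bar> \<le> C * \<bar>t\<bar> ^ (N + 1)"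
  shows "eq_upto N f g"
  using assms unfolding eq_upto_def by blast

lemma eq_upto_refl [simp]: "eq_upto N f f"
  by (rule eq_uptoI[where C = 0]) simp

lemma eq_upto_sym: "eq_upto N f g \<Longrightarrow> eq_upto N g f"
  by (simp add: eq_upto_def abs_minus_commute)

lemma eq_upto_add:
  assumes "eq_upto N f g" "eq_upto N f' g'"
  shows "eq_upto N (\<lambda>t. f t + f' t) (\<lambda>t. g t + g' t)"
proof -
  obtain C C' where C: "\<And>t. \<bar>t\<bar> \<le> 1 \<Longrightarrow> \<bar>f t - g t\<bar> \<le> C * \<bar>t\<bar> ^ (N + 1)"
      "\<And>t. \<bar>t\<bar> \<le> 1 \<Longrightarrow> \<bar>f' t - g' t\<bar> \<le> C' * \<bar>t\<bar> ^ (N + 1)"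
    using assms unfolding eq_upto_def by blast
  show ?thesis
  proof (rule eq_uptoI)
    show "\<bar>f t + f' t - (g t + g' t)\<bar> \<le> (C + C') * \<bar>t\<bar> ^ (N + 1)" if "\<bar>t\<bar> \<le> 1" for t
      using C(1)[OF that] C(2)[OF that] unfolding distrib_right by linarith
  qed
qed

lemma eq_upto_mult:
  assumes "eq_upto N f g" "\<And>t. \<bar>t\<bar> \<le> 1 \<Longrightarrow> \<bar>k t\<bar> \<le> K"
  shows "eq_upto N (\<lambda>t. k t * f t) (\<lambda>t. k t * g t)"
proof -
  obtain C where C: "\<And>t. \<bar>t\<bar> \<le> 1 \<Longrightarrow> \<bar>f t - g t\<bar> \<le> C * \<bar>t\<bar> ^ (N + 1)"
    using assms(1) unfolding eq_upto_def by blast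
  show ?thesis
  proof (rule eq_uptoI)
    show "\<bar>k t * f t - k t * g t\<bar> \<le> (K * C) * \<bar>t\<bar> ^ (N + 1)" if t: "\<bar>t\<bar> \<le> 1" for t
    proof -
      have "\<bar>k t\<bar> * \<bar>f t - g t\<bar> \<le> K * (C * \<bar>t\<bar> ^ (N + 1))"
        by (rule mult_mono[OF assms(2)[OF t] C[OF t]]) (use assms(2)[of 0] in auto)
      then show ?thesis by (simp add: right_diff_distrib flip: abs_mult)
    qed
  qed
qed

lemma eq_upto_diff:
  assumes "eq_upto N f g" "eq_upto N f' g'"
  shows "eq_upto N (\<lambda>t. f t - f' t) (\<lambda>t. g t - g' t)"
  using eq_upto_add[OF assms(1) eq_upto_mult[OF assms(2), of "\<lambda>_. - 1" 1]] by simp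

lemma eq_upto_trans [trans]:
  assumes "eq_upto N f g" "eq_upto N g h"
  shows "eq_upto N f h"
  using eq_upto_diff[OF eq_upto_add[OF assms] eq_upto_refl[of N g]] by simp

lemma eq_upto_sum:
  assumes "\<And>i. i \<in> A \<Longrightarrow> eq_upto N (f i) (g i)"
  shows "eq_upto N (\<lambda>t. \<Sum>i\<in>A. f i t) (\<lambda>t. \<Sum>i\<in>A. g i t)"
  using assms by (induction A rule: infinite_finite_induct) (auto intro: eq_upto_add)

lemma eq_upto_fps_mult:
  "eq_upto N (\<lambda>t. fps_partial_sum N p t * fps_partial_sum N q t) (fps_partial_sum N (p * q))"
proof -
  define A where "A r = (\<Sum>n\<le>N. \<bar>fps_nth r n\<bar>)" for r :: "real fps"
  have A: "\<bar>fps_nth r n\<bar> \<le> A r" if "n \<le> N" for r n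
    unfolding A_def by (rule member_le_sum) (use that in auto)
  show ?thesis
    by (rule eq_uptoI, rule fps_partial_sum_mult[OF A A])
qed

lemma fps_partial_sum_const: "fps_partial_sum N (fps_const c) t = c"
proof -
  have "fps_partial_sum N (fps_const c) t = (\<Sum>n\<le>N. if n = 0 then c else 0)"
    unfolding fps_partial_sum_def by (intro sum.cong) auto
  then show ?thesis by simp
qed

lemma fps_partial_sum_add: "fps_partial_sum N (X + Y) t = fps_partial_sum N X t + fps_partial_sum N Y t"
  by (simp add: fps_partial_sum_def scaleR_add_right sum.distrib)

lemma fps_partial_sum_diff: "fps_partial_sum N (X - Y) t = fps_partial_sum N X t - fps_partial_sum N Y t"
  by (simp add: fps_partial_sum_def scaleR_diff_right sum_subtractf)

lemma fps_partial_sum_const_mult: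
  fixes X :: "real fps"
  shows "fps_partial_sum N (fps_const c * X) t = c * fps_partial_sum N X t"
  by (simp add: fps_partial_sum_def sum_distrib_left mult_ac)

lemma fps_partial_sum_X_power: "i \<le> N \<Longrightarrow> fps_partial_sum N (fps_X ^ i :: real fps) t = t ^ i"
  unfolding fps_partial_sum_def by (simp add: fps_X_power_nth if_distrib cong: if_cong)

lemma eq_upto_X_power_mult:
  assumes "i \<le> N"
  shows "eq_upto N (\<lambda>t. t ^ i * fps_partial_sum N q t) (fps_partial_sum N (fps_X ^ i * q))"
  using eq_upto_fps_mult[of N "fps_X ^ i" q] by (simp add: fps_partial_sum_X_power[OF assms])

text \<open>This discards the surplus term created by multiplication with \<epsilon>; continuity of
  its coefficient provides the bound on [-1,1].\<close>

lemma eq_upto_power_mult: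
  assumes "continuous_on {-1..1} c" "n > N"
  shows "eq_upto N (\<lambda>t. t ^ n * c t) (\<lambda>_. 0)"
proof -
  have "bounded (c ` {-1..1})"
    by (intro compact_imp_bounded compact_continuous_image assms compact_Icc)
  then obtain K where K: "\<And>t. t \<in> {-1..1} \<Longrightarrow> \<bar>c t\<bar> \<le> K"
    unfolding bounded_iff by (metis imageI real_norm_def)
  have "0 \<le> K" using order_trans[OF abs_ge_zero K[of 0]] by simp
  show ?thesis
  proof (rule eq_uptoI)
    fix t :: real assume t: "\<bar>t\<bar> \<le> 1"
    have "\<bar>c t\<bar> * \<bar>t\<bar> ^ n \<le> K * \<bar>t\<bar> ^ (N + 1)"
      by (intro mult_mono K power_decreasing) (use t assms(2) \<open>0 \<le> K\<close> in auto)
    then show "\<bar>t ^ n * c t - 0\<bar> \<le> K * \<bar>t\<bar> ^ (N + 1)"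
      by (simp add: abs_mult power_abs mult.commute)
  qed
qed

lemma eq_upto_zero_imp_nth_zero:
  assumes "eq_upto N (fps_partial_sum N R) (\<lambda>_. 0)" "n \<le> N"
  shows "fps_nth R n = 0"
proof -
  obtain C where C: "\<And>t. \<bar>t\<bar> \<le> 1 \<Longrightarrow> \<bar>fps_partial_sum N R t - 0\<bar> \<le> C * \<bar>t\<bar> ^ (N + 1)"
    using assms(1) unfolding eq_upto_def by blast
  show ?thesis
  proof (rule polynomial_coeffs_0_if_small[OF _ assms(2)])
    show "\<bar>\<Sum>n\<le>N. t ^ n * fps_nth R n\<bar> \<le> C * t ^ (N + 1)" if "0 < t" "t \<le> 1" for t
      using C[of t] that by (simp add: fps_partial_sum_def)
  qed
qed

lemma fps_nth_bounded_upto: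
  fixes X :: "'a::real_normed_vector fps"
  obtains R where "R \<ge> 0" "\<And>n. n \<le> N \<Longrightarrow> norm (fps_nth X n) \<le> R"
proof
  show "0 \<le> (\<Sum>n\<le>N. norm (fps_nth X n))" by (simp add: sum_nonneg)
  show "norm (fps_nth X n) \<le> (\<Sum>n\<le>N. norm (fps_nth X n))" if "n \<le> N" for n
    by (rule member_le_sum) (use that in auto)
qed

lemma eq_upto_taylor_subst:
  assumes "smooth f"
  shows "eq_upto N (\<lambda>t. f (fps_partial_sum N X t)) (fps_partial_sum N (taylor_subst f X))"
proof -
  obtain R where R: "R \<ge> 0" "\<And>n. n \<le> N \<Longrightarrow> norm (fps_nth X n) \<le> R"
    using fps_nth_bounded_upto[of N X] by metis
  obtain C where "\<And>Y t. (\<And>n. n \<le> N \<Longrightarrow> norm (fps_nth Y n) \<le> R) \<Longrightarrow> \<bar>t\<bar> \<le> 1 \<Longrightarrow>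
      \<bar>f (fps_partial_sum N Y t) - fps_partial_sum N (taylor_subst f Y) t\<bar> \<le> C * \<bar>t\<bar> ^ (N + 1)"
    using taylor_subst_approx[OF assms R(1), of N] by metis
  from this[OF R(2)] show ?thesis by (rule eq_uptoI)
qed

lemma eq_upto_series_subst:
  assumes "\<And>n. smooth (F n)"
  shows "eq_upto N (\<lambda>t. \<Sum>i\<le>N. t ^ i * F i (fps_partial_sum N X t)) (fps_partial_sum N (series_subst F X))"
proof -
  have "eq_upto N (\<lambda>t. \<Sum>i\<le>N. t ^ i * F i (fps_partial_sum N X t))
      (\<lambda>t. \<Sum>i\<le>N. t ^ i * fps_partial_sum N (taylor_subst (F i) X) t)"
    by (intro eq_upto_sum eq_upto_mult[where K = 1] eq_upto_taylor_subst assms)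
      (auto simp: power_abs power_le_one)
  also have "eq_upto N \<dots> (\<lambda>t. \<Sum>i\<le>N. fps_partial_sum N (fps_X ^ i * taylor_subst (F i) X) t)"
    by (intro eq_upto_sum eq_upto_X_power_mult) auto
  also have "(\<lambda>t. \<Sum>i\<le>N. fps_partial_sum N (fps_X ^ i * taylor_subst (F i) X) t)
      = fps_partial_sum N (series_subst F X)"
  proof
    fix t
    have "(\<Sum>i\<le>N. fps_partial_sum N (fps_X ^ i * taylor_subst (F i) X) t)
        = (\<Sum>n\<le>N. t ^ n * (\<Sum>i\<le>N. fps_nth (fps_X ^ i * taylor_subst (F i) X) n))"
      unfolding fps_partial_sum_def by (subst sum.swap) (simp add: sum_distrib_left)
    also have "\<dots> = (\<Sum>n\<le>N. t ^ n * fps_nth (series_subst F X) n)"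
    proof (rule sum.cong[OF refl])
      fix n assume "n \<in> {..N}"
      then have "(\<Sum>i\<le>N. fps_nth (fps_X ^ i * taylor_subst (F i) X) n) = fps_nth (series_subst F X) n"
        unfolding series_subst_nth
        by (intro sum.mono_neutral_cong_right) (auto simp: fps_X_power_mult_nth)
      then show "t ^ n * (\<Sum>i\<le>N. fps_nth (fps_X ^ i * taylor_subst (F i) X) n) = t ^ n * fps_nth (series_subst F X) n"
        by simp
    qed
    finally show "(\<Sum>i\<le>N. fps_partial_sum N (fps_X ^ i * taylor_subst (F i) X) t) = fps_partial_sum N (series_subst F X) t"
      by (simp add: fps_partial_sum_def)
  qed
  finally show ?thesis .
qed

text \<open>Taylor's formula of length one; the radius is doubled because the increment between two
  points of the ball can have norm up to 2R.\<close>

lemma smooth_lipschitz_on_cball: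
  fixes f :: "'a::euclidean_space \<Rightarrow> real"
  assumes "smooth f"
  obtains L where "L \<ge> 0" "\<And>x y. norm x \<le> R \<Longrightarrow> norm y \<le> R \<Longrightarrow> \<bar>f y - f x\<bar> \<le> L * norm (y - x)"
proof -
  obtain C where C: "C \<ge> 0" "\<And>x h. norm x \<le> 2 * R \<Longrightarrow> norm h \<le> 2 * R \<Longrightarrow>
    \<bar>f (x + h) - (\<Sum>j<1. differential f j x h / fact j)\<bar> \<le> C * norm h ^ 1"
    using multivariate_taylor[OF assms, of "2 * R" 1] by blast
  show ?thesis
  proof
    fix x y :: 'a assume xy: "norm x \<le> R" "norm y \<le> R"
    have "norm (y - x) \<le> 2 * R" using xy norm_triangle_ineq4[of y x] by linarith
    moreover have "norm x \<le> 2 * R" using xy(1) norm_ge_zero[of x] by linarith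
    ultimately show "\<bar>f y - f x\<bar> \<le> C * norm (y - x)"
      using C(2)[of x "y - x"] by (simp add: differential_def)
  qed (rule C)
qed

lemma continuous_on_fps_partial_sum:
  "continuous_on S (fps_partial_sum N (X :: real fps))"
  unfolding fps_partial_sum_def[abs_def] by (intro continuous_intros)

lemma subst_eta_solution:
  fixes v :: "nat \<Rightarrow> real ^ ('m::finite option) \<Rightarrow> real"
  assumes sol: "normalized_formal_solution W \<beta> \<Omega> v lam" and W: "smooth W"
    and H: "series_subst lam H = 0"
  shows "subst_eta v H (\<psi> + \<Omega>) + subst_eta v H (\<psi> - \<Omega>) - 2 * subst_eta v H \<psi>
    + fps_X * taylor_subst W
        (Abs_fps (\<lambda>n. point (fps_nth (fps_const \<psi>) n) (fps_nth H n)
                      + fps_nth (subst_eta v H \<psi>) n *\<^sub>R \<beta>)) = 0" (is "?R = 0")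
proof -
  note v = formal_solution_analytic(2)[OF sol]
  note lam = formal_solution_analytic(3)[OF sol]
  define Y where "Y = Abs_fps (\<lambda>n. point (fps_nth (fps_const \<psi>) n) (fps_nth H n)
                      + fps_nth (subst_eta v H \<psi>) n *\<^sub>R \<beta>)"
  define X where "X \<eta> = fps_const (point \<psi> \<eta>) + Abs_fps (\<lambda>n. v n (point \<psi> \<eta>) *\<^sub>R \<beta>)" for \<eta>
  \<comment> \<open>The Taylor coefficients of W while \<eta> is held fixed; H is inserted into them
    only afterwards.\<close>
  define w where "w n \<eta> = fps_nth (taylor_subst W (X \<eta>)) n" for n \<eta>
  have eq: "v n (point (\<psi> + \<Omega>) \<eta>) + v n (point (\<psi> - \<Omega>) \<eta>) - 2 * v n (point \<psi> \<eta>)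
      + (if n = 0 then 0 else w (n - 1) \<eta>) + lam n \<eta> = 0" for n \<eta>
    using formal_solution_nth[OF sol, of n \<psi> \<eta>] unfolding w_def X_def .
  have "fps_nth ?R n = 0" for n
  proof -
    \<comment> \<open>One more than the order wanted, so that N \<ge> 1 and \<epsilon> itself
      survives truncation.\<close>
    define N where "N = Suc n"
    define h where "h = fps_partial_sum N H"
    define S where "S \<psi>' t = (\<Sum>i\<le>N. t ^ i * v i (point \<psi>' (h t)))" for \<psi>' t
    have h: "continuous_on A h" for A
      unfolding h_def by (rule continuous_on_fps_partial_sum)
    have S: "eq_upto N (S \<psi>') (fps_partial_sum N (subst_eta v H \<psi>'))" for \<psi>'
      unfolding S_def subst_eta_def h_def by (rule eq_upto_series_subst) (rule smooth_slice[OF v])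
    have S_cont: "continuous_on A (S \<psi>')" for A \<psi>'
      unfolding S_def by (intro continuous_intros smooth_continuous_on_compose[OF v] h)
    have lam_0: "eq_upto N (\<lambda>t. \<Sum>i\<le>N. t ^ i * lam i (h t)) (\<lambda>_. 0)"
      using eq_upto_series_subst[where F = lam and X = H and N = N, OF lam]
      unfolding H h_def by (simp add: fps_partial_sum_def[of N "0 :: real fps", abs_def])
    \<comment> \<open>The true point at which W is evaluated once \<eta> = h(t). It links both
      expansions: W along \<Phi> is compared with the series in Y and with the coefficients w at
      \<eta> = h(t).\<close>
    define \<Phi> where "\<Phi> t = point \<psi> (h t) + S \<psi> t *\<^sub>R \<beta>" for t
    have \<Phi>: "fps_partial_sum N (X (h t)) t = \<Phi> t" for t
      unfolding X_def \<Phi>_def S_def fps_partial_sum_add fps_partial_sum_const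
      by (simp add: fps_partial_sum_def scaleR_sum_left)
    have Y: "fps_partial_sum N Y t = point \<psi> (h t) + fps_partial_sum N (subst_eta v H \<psi>) t *\<^sub>R \<beta>" for t
    proof -
      have "(\<Sum>i\<le>N. t ^ i *\<^sub>R fps_nth (fps_const \<psi>) i) = \<psi>"
        using fps_partial_sum_const[of N \<psi> t] by (simp only: fps_partial_sum_def)
      then have "point \<psi> (h t) = (\<Sum>i\<le>N. point (t ^ i *\<^sub>R fps_nth (fps_const \<psi>) i) (t ^ i * fps_nth H i))"
        unfolding point_sum[symmetric] h_def fps_partial_sum_def by simp
      then show ?thesis
        unfolding fps_partial_sum_def Y_def
        by (simp add: scaleR_add_right sum.distrib scaleR_sum_left point_scaleR)
    qed
    \<comment> \<open>The two arguments differ only along \<beta>, by an error O(t^(N+1)), and W is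
      Lipschitz on a ball containing both curves.\<close>
    have "eq_upto N (\<lambda>t. W (\<Phi> t)) (\<lambda>t. W (fps_partial_sum N Y t))"
    proof -
      obtain C where C: "\<And>t. \<bar>t\<bar> \<le> 1 \<Longrightarrow> \<bar>S \<psi> t - fps_partial_sum N (subst_eta v H \<psi>) t\<bar> \<le> C * \<bar>t\<bar> ^ (N + 1)"
        using S unfolding eq_upto_def by blast
      have "continuous_on {-1..1} \<Phi>" "continuous_on {-1..1} (fps_partial_sum N Y)"
        unfolding \<Phi>_def Y by (intro continuous_intros h S_cont continuous_on_fps_partial_sum)+
      then have "bounded (\<Phi> ` {-1..1} \<union> fps_partial_sum N Y ` {-1..1})"
        by (intro bounded_Un[THEN iffD2] conjI compact_imp_bounded compact_continuous_image compact_Icc)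
      then obtain R where R: "\<And>t. t \<in> {-1..1} \<Longrightarrow> norm (\<Phi> t) \<le> R" "\<And>t. t \<in> {-1..1} \<Longrightarrow> norm (fps_partial_sum N Y t) \<le> R"
        unfolding bounded_iff by blast
      obtain L where L: "L \<ge> 0" "\<And>x y. norm x \<le> R \<Longrightarrow> norm y \<le> R \<Longrightarrow> \<bar>W y - W x\<bar> \<le> L * norm (y - x)"
        using smooth_lipschitz_on_cball[OF W] by blast
      show ?thesis
      proof (rule eq_uptoI)
        fix t :: real assume t: "\<bar>t\<bar> \<le> 1"
        have "\<bar>W (\<Phi> t) - W (fps_partial_sum N Y t)\<bar> \<le> L * norm (\<Phi> t - fps_partial_sum N Y t)"
          using t by (intro L R) auto
        also have "\<Phi> t - fps_partial_sum N Y t = (S \<psi> t - fps_partial_sum N (subst_eta v H \<psi>) t) *\<^sub>R \<beta>"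
          by (simp add: \<Phi>_def Y scaleR_diff_left)
        also have "L * norm \<dots> \<le> L * (C * \<bar>t\<bar> ^ (N + 1) * norm \<beta>)"
          unfolding norm_scaleR real_norm_def by (intro mult_left_mono mult_right_mono C t L) auto
        finally show "\<bar>W (\<Phi> t) - W (fps_partial_sum N Y t)\<bar> \<le> (L * C * norm \<beta>) * \<bar>t\<bar> ^ (N + 1)"
          by (simp add: mult_ac)
      qed
    qed
    also have "eq_upto N \<dots> (fps_partial_sum N (taylor_subst W Y))"
      by (rule eq_upto_taylor_subst[OF W])
    finally have W_Y: "eq_upto N (\<lambda>t. W (\<Phi> t)) (fps_partial_sum N (taylor_subst W Y))" .
    have W_w: "eq_upto N (\<lambda>t. W (\<Phi> t)) (\<lambda>t. \<Sum>i\<le>N. t ^ i * w i (h t))"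
    proof -
      \<comment> \<open>The inner series moves with t. Its coefficients stay bounded over [-1,1], so
        the uniform constant of \<open>taylor_subst_approx\<close> serves all of them at
        once.\<close>
      have "\<exists>R\<ge>0. \<forall>t\<in>{-1..1}. norm (fps_nth (X (h t)) i) \<le> R" for i
      proof -
        have "continuous_on {-1..1} (\<lambda>t. fps_nth (X (h t)) i)"
          unfolding X_def by (cases "i = 0") (auto intro!: continuous_intros smooth_continuous_on_compose[OF v] h)
        then have "bounded ((\<lambda>t. fps_nth (X (h t)) i) ` {-1..1})"
          by (intro compact_imp_bounded compact_continuous_image compact_Icc)
        then show ?thesis unfolding bounded_pos by (auto intro: less_imp_le)
      qed
      then obtain R' where R': "\<And>i. R' i \<ge> 0" "\<And>i t. t \<in> {-1..1} \<Longrightarrow> norm (fps_nth (X (h t)) i) \<le> R' i"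
        by metis
      define R where "R = (\<Sum>i\<le>N. R' i)"
      have R: "R \<ge> 0" unfolding R_def by (intro sum_nonneg R')
      have "norm (fps_nth (X (h t)) i) \<le> R" if "i \<le> N" "\<bar>t\<bar> \<le> 1" for i t
        using R'(2)[of t i] member_le_sum[of i "{..N}" R'] R'(1) that unfolding R_def by fastforce
      moreover obtain C where "\<And>Z t. (\<And>i. i \<le> N \<Longrightarrow> norm (fps_nth Z i) \<le> R) \<Longrightarrow> \<bar>t\<bar> \<le> 1 \<Longrightarrow>
          \<bar>W (fps_partial_sum N Z t) - fps_partial_sum N (taylor_subst W Z) t\<bar> \<le> C * \<bar>t\<bar> ^ (N + 1)"
        using taylor_subst_approx[OF W R, of N] by metis
      ultimately have "\<bar>W (fps_partial_sum N (X (h t)) t) - fps_partial_sum N (taylor_subst W (X (h t))) t\<bar>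
          \<le> C * \<bar>t\<bar> ^ (N + 1)" if "\<bar>t\<bar> \<le> 1" for t
        using that by blast
      then show ?thesis
        unfolding \<Phi> unfolding fps_partial_sum_def w_def real_scaleR_def by (rule eq_uptoI)
    qed
    \<comment> \<open>The equation of order N+1 expresses w(N) through v and \<open>lam\<close>,
      whose continuity is known.\<close>
    have "continuous_on {-1..1} (\<lambda>t. w N (h t))"
    proof -
      have "w N \<eta> = - (v (Suc N) (point (\<psi> + \<Omega>) \<eta>) + v (Suc N) (point (\<psi> - \<Omega>) \<eta>) - 2 * v (Suc N) (point \<psi> \<eta>)
          + lam (Suc N) \<eta>)" for \<eta>
        using eq[of "Suc N" \<eta>] by simp
      then show ?thesis
        by (simp only:) (intro continuous_intros smooth_continuous_on_compose[OF v] smooth_continuous_on_compose[OF lam] h)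
    qed
    then have last: "eq_upto N (\<lambda>t. t ^ Suc N * w N (h t)) (\<lambda>_. 0)"
      by (rule eq_upto_power_mult) simp
    have "eq_upto N (fps_partial_sum N (fps_X * taylor_subst W Y)) (\<lambda>t. t * fps_partial_sum N (taylor_subst W Y) t)"
      using eq_upto_sym[OF eq_upto_X_power_mult[of 1 N]] by (simp add: N_def)
    also have "eq_upto N \<dots> (\<lambda>t. t * (\<Sum>i\<le>N. t ^ i * w i (h t)))"
      by (rule eq_upto_mult[where K = 1, OF eq_upto_trans[OF eq_upto_sym[OF W_Y] W_w]])
    also have "(\<lambda>t. t * (\<Sum>i\<le>N. t ^ i * w i (h t)))
        = (\<lambda>t. (\<Sum>i\<le>N. t ^ i * (if i = 0 then 0 else w (i - 1) (h t))) + t ^ Suc N * w N (h t))"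
    proof
      fix t
      have "t * (\<Sum>i\<le>N. t ^ i * w i (h t)) = (\<Sum>i\<le>N. t ^ Suc i * w i (h t))"
        by (simp add: sum_distrib_left mult_ac)
      also have "\<dots> = (\<Sum>i\<le>Suc N. t ^ i * (if i = 0 then 0 else w (i - 1) (h t)))"
        by (subst sum.atMost_Suc_shift) simp
      finally show "t * (\<Sum>i\<le>N. t ^ i * w i (h t))
        = (\<Sum>i\<le>N. t ^ i * (if i = 0 then 0 else w (i - 1) (h t))) + t ^ Suc N * w N (h t)"
        by simp
    qed
    \<comment> \<open>The surplus term of degree N+1 is dropped; the literal \<open>+ 0\<close>
      keeps the shape produced by \<open>eq_upto_add\<close>.\<close>
    also have "eq_upto N \<dots> (\<lambda>t. (\<Sum>i\<le>N. t ^ i * (if i = 0 then 0 else w (i - 1) (h t))) + 0)"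
      by (rule eq_upto_add[OF eq_upto_refl last])
    finally have XW: "eq_upto N (fps_partial_sum N (fps_X * taylor_subst W Y))
        (\<lambda>t. (\<Sum>i\<le>N. t ^ i * (if i = 0 then 0 else w (i - 1) (h t))) + 0)" .
    define Z where "Z t = S (\<psi> + \<Omega>) t + S (\<psi> - \<Omega>) t - 2 * S \<psi> t
        + ((\<Sum>i\<le>N. t ^ i * (if i = 0 then 0 else w (i - 1) (h t))) + 0)" for t
    have R: "fps_partial_sum N ?R = (\<lambda>t. fps_partial_sum N (subst_eta v H (\<psi> + \<Omega>)) t
        + fps_partial_sum N (subst_eta v H (\<psi> - \<Omega>)) t - 2 * fps_partial_sum N (subst_eta v H \<psi>) t
        + fps_partial_sum N (fps_X * taylor_subst W Y) t)"
      unfolding Y_def[symmetric]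
      by (rule ext) (simp only: fps_partial_sum_add fps_partial_sum_diff numeral_fps_const fps_partial_sum_const_mult)
    have "eq_upto N (fps_partial_sum N ?R) Z"
      unfolding R Z_def[abs_def]
      by (intro eq_upto_add eq_upto_diff eq_upto_mult[where K = 2] XW eq_upto_sym[OF S]) auto
    \<comment> \<open>The fixed-\<eta> equations of orders up to N at \<eta> = h(t), weighted with
      powers of t. Their \<open>lam\<close> part is O(t^(N+1)) because H annihilates the substituted
      series.\<close>
    moreover have "Z t = 0 - (\<Sum>i\<le>N. t ^ i * lam i (h t))" for t
    proof -
      have "Z t + (\<Sum>i\<le>N. t ^ i * lam i (h t))
        = (\<Sum>i\<le>N. t ^ i * (v i (point (\<psi> + \<Omega>) (h t)) + v i (point (\<psi> - \<Omega>) (h t)) - 2 * v i (point \<psi> (h t))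
          + (if i = 0 then 0 else w (i - 1) (h t)) + lam i (h t)))"
        unfolding Z_def S_def by (simp add: distrib_left right_diff_distrib sum.distrib sum_subtractf sum_distrib_left mult_ac)
      also have "\<dots> = 0" by (simp only: eq) simp
      finally show ?thesis by simp
    qed
    then have "Z = (\<lambda>t. 0 - (\<Sum>i\<le>N. t ^ i * lam i (h t)))" by (rule ext)
    then have "eq_upto N Z (\<lambda>t. 0 - 0)"
      by (simp only:) (rule eq_upto_diff[OF eq_upto_refl lam_0])
    ultimately have "eq_upto N (fps_partial_sum N ?R) (\<lambda>t. 0 - 0)"
      by (rule eq_upto_trans)
    then have "eq_upto N (fps_partial_sum N ?R) (\<lambda>_. 0)" by simp
    then show ?thesis by (rule eq_upto_zero_imp_nth_zero) (simp add: N_def)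
  qed
  then show ?thesis by (simp add: fps_eq_iff)
qed

theorem theorem3:
  fixes V W :: "real ^ ('m::finite option) \<Rightarrow> real"
    and \<alpha> \<beta> :: "real ^ ('m option)"
    and \<omega> :: real
    and B :: "int ^ ('m option) ^ ('m option)"
    and \<Omega> :: "real ^ 'm"
    and L :: "int ^ ('m option)"
    and v :: "nat \<Rightarrow> real ^ ('m option) \<Rightarrow> real"
    and lam :: "nat \<Rightarrow> real \<Rightarrow> real"
    and \<eta>star :: real
  assumes V_analytic: "torus_analytic V"
    and \<alpha>_nonresonant: "\<And>k :: int ^ ('m option). k \<noteq> 0 \<Longrightarrow> real_vec k \<bullet> \<alpha> \<noteq> 0"
    and \<omega>_resonant: "\<exists>k :: int ^ ('m option). \<exists>m :: int.
           k \<noteq> 0 \<and> real_vec k \<bullet> (\<omega> *\<^sub>R \<alpha>) = of_int m"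
    and B_SL: "det B = 1"
    and B_\<omega>\<alpha>: "map_matrix real_of_int B *v (\<omega> *\<^sub>R \<alpha>) = point \<Omega> 0 + real_vec L"
    and \<Omega>_nonresonant: "\<And>k :: int ^ 'm. k \<noteq> 0 \<Longrightarrow> \<Omega> \<bullet> real_vec k \<notin> \<int>"
    and \<beta>: "\<beta> = map_matrix real_of_int B *v \<alpha>"
    and W: "\<And>\<theta>. W (map_matrix real_of_int B *v \<theta>) = dir_deriv \<alpha> V \<theta>"
    and W_analytic: "torus_analytic W"
    and small_divisors: "small_divisor_condition \<Omega>"
    and solution: "normalized_formal_solution W \<beta> \<Omega> v lam"
    and \<eta>star_zero: "torus_integral (\<lambda>\<psi>. W (point \<psi> \<eta>star)) = 0"
    and \<eta>star_nondegenerate: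
      "torus_integral (\<lambda>\<psi>. dir_deriv (axis None 1) W (point \<psi> \<eta>star)) \<noteq> 0"
  shows "\<exists>H :: real fps. fps_nth H 0 = \<eta>star \<and>
           series_subst lam H = 0 \<and>
           (\<forall>\<psi>. subst_eta v H (\<psi> + \<Omega>) + subst_eta v H (\<psi> - \<Omega>) - 2 * subst_eta v H \<psi>
              + fps_X * taylor_subst W
                  (Abs_fps (\<lambda>n. point (fps_nth (fps_const \<psi>) n) (fps_nth H n)
                                + fps_nth (subst_eta v H \<psi>) n *\<^sub>R \<beta>)) = 0)"
proof -
  have W_smooth: "smooth W"
    by (rule real_analytic_imp_smooth) (use W_analytic in \<open>simp add: torus_analytic_def\<close>)
  have lam_0: "lam 0 = (\<lambda>_. 0)"
    by (rule formal_solution_order_0(1)[OF solution \<Omega>_nonresonant])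
  have lam_1: "lam 1 = (\<lambda>\<eta>. - torus_integral (\<lambda>\<psi>. W (point \<psi> \<eta>)))"
    using formal_solution_lam_1[OF solution \<Omega>_nonresonant W_smooth] by blast
  have "lam 1 \<eta>star = 0"
    unfolding lam_1 by (simp add: \<eta>star_zero)
  \<comment> \<open>This derivative is minus the integral assumed to be nonzero.\<close>
  moreover have "dir_deriv 1 (lam 1) \<eta>star \<noteq> 0"
    using dir_deriv_real[OF DERIV_minus[OF torus_integral_has_field_derivative[OF W_smooth]]]
      \<eta>star_nondegenerate unfolding lam_1 by simp
  ultimately obtain H where "fps_nth H 0 = \<eta>star" "series_subst lam H = 0"
    using formal_implicit_function[of lam \<eta>star] lam_0 by blast
  then show ?thesis
    using subst_eta_solution[OF solution W_smooth] by blast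
qed

end
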